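(* Let $\mathscr{U}=(U,\mathcal{A},\lambda)$ be a linear reflexive object in a Cartesian closed differential category $\mathbf{C}$. Then the equational theory $\mathrm{Th}(\mathscr{U})$ is a differential $\lambda$-theory; i.e. $\mathscr{U}$ is a sound model of the untyped differential $\lambda$-calculus.
   Context: Cartesian closed differential categories. A left-additive category is a category whose homsets $\mathbf{C}(A,B)$ are commutative monoids $(+,0)$ with $(g+h)\circ f=g\circ f+h\circ f$ and $0\circ f=0$. A morphism $f$ is additive if $f\circ(g+h)=f\circ g+f\circ h$ and $f\circ 0=0$. A Cartesian left-additive category is a left-additive category with finite products in which projections are additive and pairings of additive maps are additive. A Cartesian differential category is a Cartesian left-additive category with an operator $D$ sending $f:A\to B$ to $D(f):A\times A\to B$ such that: (D1) $D(f+g)=D(f)+D(g)$, $D(0)=0$; (D2) $D(f)\circ\langle h+k,v\rangle=D(f)\circ\langle h,v\rangle+D(f)\circ\langle k,v\rangle$, $D(f)\circ\langle 0,v\rangle=0$; (D3) $D(\mathrm{Id})=\pi_1$, $D(\pi_1)=\pi_1\circ\pi_1$, $D(\pi_2)=\pi_2\circ\pi_1$; (D4) $D(\langle f,g\rangle)=\langle D(f),D(g)\rangle$; (D5) $D(f\circ g)=D(f)\circ\langle D(g),g\circ\pi_2\rangle$; (D6) $D(D(f))\circ\langle\langle g,0\rangle,\langle h,k\rangle\rangle=D(f)\circ\langle g,k\rangle$; (D7) $D(D(f))\circ\langle\langle 0,h\rangle,\langle g,k\rangle\rangle=D(D(f))\circ\langle\langle 0,g\rangle,\langle h,k\rangle\rangle$.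 A Cartesian closed differential category is a Cartesian differential category which is Cartesian closed (exponential $[A\Rightarrow B]$, evaluation $\mathrm{ev}$, currying $\Lambda$) with $\Lambda(f+g)=\Lambda(f)+\Lambda(g)$, $\Lambda(0)=0$, and, for every $f:C\times A\to B$, $D(\Lambda(f))=\Lambda(D(f)\circ\langle\pi_1\times 0_A,\pi_2\times\mathrm{Id}_A\rangle)$. Here $h\times k=\langle h\circ\pi_1,k\circ\pi_2\rangle$ and $\Lambda^-(h)=\mathrm{ev}\circ(h\times\mathrm{Id})$. A morphism $f$ is linear if $D(f)=f\circ\pi_1$. For $f:C\times A\to B$ and $g:C\to A$ put $f\star g=D(f)\circ\langle\langle 0_C,g\circ\pi_1\rangle,\mathrm{Id}_{C\times A}\rangle:C\times A\to B$. Linear reflexive object: a triple $(U,\mathcal{A},\lambda)$ with $\mathcal{A}:U\to[U\Rightarrow U]$, $\lambda:[U\Rightarrow U]\to U$, $\mathcal{A}\circ\lambda=\mathrm{Id}$, both $\mathcal{A}$ and $\lambda$ linear. Syntax. Differential $\lambda$-terms $S,T::=0\mid s\mid s+T$ and simple terms $s,t::=x\mid\lambda x.s\mid sT\mid \mathsf{D}s\cdot t$, taken up to $\alpha$-conversion, associativity/commutativity of $+$, $S+0=S$, and the permutative equality $\mathsf{D}^n s\cdot(t_1,\dots,t_n)=\mathsf{D}^n s\cdot(t_{\sigma(1)},\dots,t_{\sigma(n)})$, where $\mathsf{D}^1s\cdot t=\mathsf{D}s\cdot t$ and $\mathsf{D}^{n+1}s\cdot(t,t_1,\dots,t_n)=\mathsf{D}^n(\mathsf{D}s\cdot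 t)\cdot(t_1,\dots,t_n)$. Abbreviations: $\lambda x.\sum_i s_i=\sum_i\lambda x.s_i$, $(\sum_i s_i)T=\sum_i s_iT$, $\mathsf{D}(\sum_i s_i)\cdot(\sum_j t_j)=\sum_{i,j}\mathsf{D}s_i\cdot t_j$. Free variables as usual ($\mathrm{FV}(\mathsf{D}s\cdot t)=\mathrm{FV}(s)\cup\mathrm{FV}(t)$, $\mathrm{FV}(0)=\emptyset$). $S\{T/x\}$ is capture-free substitution (componentwise on all constructors, $0\{T/x\}=0$). The differential substitution $\frac{\partial S}{\partial x}\cdot T$ is defined by: $\frac{\partial y}{\partial x}\cdot T=T$ if $y=x$, $0$ otherwise; $\frac{\partial (sU)}{\partial x}\cdot T=(\frac{\partial s}{\partial x}\cdot T)U+(\mathsf{D}s\cdot(\frac{\partial U}{\partial x}\cdot T))U$; $\frac{\partial(\lambda y.s)}{\partial x}\cdot T=\lambda y.\frac{\partial s}{\partial x}\cdot T$ ($y\ne x$, $y\notin\mathrm{FV}(T)$); $\frac{\partial(\mathsf{D}^n s\cdot(u_1,\dots,u_n))}{\partial x}\cdot T=\mathsf{D}^n(\frac{\partial s}{\partial x}\cdot T)\cdot(u_1,\dots,u_n)+\sum_{i=1}^n\mathsf{D}^n s\cdot(u_1,\dots,\frac{\partial u_i}{\partial x}\cdot T,\dots,u_n)$; $\frac{\partial 0}{\partial x}\cdot T=0$; $\frac{\partial(s+U)}{\partial x}\cdot T=\frac{\partial s}{\partial x}\cdot T+\frac{\partial U}{\partial x}\cdot T$. A differential $\lambda$-theory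 is a set of equations between differential $\lambda$-terms that is an equivalence relation, compatible (if $s=S$ then $\lambda x.s=\lambda x.S$; if $s=S,T=U$ then $sT=SU$; if $s=S,u=U$ then $\mathsf{D}s\cdot u=\mathsf{D}S\cdot U$; if $s_i=S_i$ for all $i$ then $\sum s_i=\sum S_i$), and contains $(\beta)$ $(\lambda x.s)T=s\{T/x\}$ and $(\beta_D)$ $\mathsf{D}(\lambda x.s)\cdot t=\lambda x.\frac{\partial s}{\partial x}\cdot t$. Interpretation. For a sequence $\vec x=x_1,\dots,x_n$ of distinct variables let $U^{\vec x}=U^{x_1,\dots,x_{n-1}}\times U$ ($U^{\emptyset}$ terminal), with projections $\pi_n^{\vec x}=\pi_2$ and $\pi_i^{\vec x}=\pi_i^{x_1,\dots,x_{n-1}}\circ\pi_1$ for $i<n$. $\vec x$ is adequate for $S$ if $\mathrm{FV}(S)\subseteq\{x_1,\dots,x_n\}$. Then $[\![S]\!]_{\vec x}:U^{\vec x}\to U$ is: $[\![x_i]\!]=\pi_i^{\vec x}$; $[\![sT]\!]=\mathrm{ev}\circ\langle\mathcal{A}\circ[\![s]\!],[\![T]\!]\rangle$; $[\![\lambda z.s]\!]_{\vec x}=\lambda\circ\Lambda([\![s]\!]_{\vec x,z})$ ($z\notin\vec x$); $[\![\mathsf{D}^1s\cdot t]\!]=\lambda\circ\Lambda(\Lambda^-(\mathcal{A}\circ[\![s]\!])\star[\![t]\!])$; $[\![\mathsf{D}^{n+1}s\cdot(t_1,\dots,t_{n+1})]\!]=\lambda\circ\Lambda(\Lambda^-(\mathcal{A}\circ[\![\mathsf{D}^ns\cdot(t_1,\dots,t_n)]\!])\star[\![t_{n+1}]\!])$;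 $[\![0]\!]=0$; $[\![s+S]\!]=[\![s]\!]+[\![S]\!]$. $\mathrm{Th}(\mathscr{U})=\{S=T\mid [\![S]\!]_{\vec x}=[\![T]\!]_{\vec x}$ for some $\vec x$ adequate for $S,T\}$. *)

theory Defs
  imports "HOL-Library.Multiset"
begin

section \<open>Cartesian closed differential categories\<close>

record ('o, 'm) cat =
  Obj :: "'o set"
  Arr :: "'m set"
  Dom :: "'m \<Rightarrow> 'o"
  Cod :: "'m \<Rightarrow> 'o"
  ident :: "'o \<Rightarrow> 'm"  (\<open>\<one>\<index>\<close>)
  compose :: "'m \<Rightarrow> 'm \<Rightarrow> 'm"  (infixr \<open>\<odot>\<index>\<close> 70)

record ('o, 'm) la_cat = "('o, 'm) cat" +
  zero_arr :: "'o \<Rightarrow> 'o \<Rightarrow> 'm"  (\<open>\<zero>\<index>\<close>)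
  add_arr :: "'m \<Rightarrow> 'm \<Rightarrow> 'm"  (infixl \<open>\<oplus>\<index>\<close> 65)

record ('o, 'm) cla_cat = "('o, 'm) la_cat" +
  terminal :: "'o"  (\<open>\<top>\<index>\<close>)
  prod_obj :: "'o \<Rightarrow> 'o \<Rightarrow> 'o"  (infixr \<open>\<otimes>\<index>\<close> 75)
  proj1 :: "'o \<Rightarrow> 'o \<Rightarrow> 'm"  (\<open>\<pi>\<^sub>1\<index>\<close>)
  proj2 :: "'o \<Rightarrow> 'o \<Rightarrow> 'm"  (\<open>\<pi>\<^sub>2\<index>\<close>)
  pairing :: "'m \<Rightarrow> 'm \<Rightarrow> 'm"  (\<open>\<langle>_, _\<rangle>\<index>\<close>)

record ('o, 'm) cd_cat = "('o, 'm) cla_cat" +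
  diff_op :: "'m \<Rightarrow> 'm"  (\<open>D\<index>\<close>)

text \<open>In \<open>\<Lambda> X A f\<close> the objects \<open>X\<close> and \<open>A\<close> are explicit because the
  product object \<open>Dom f\<close> need not determine its factors.\<close>

record ('o, 'm) ccd_cat = "('o, 'm) cd_cat" +
  exp_obj :: "'o \<Rightarrow> 'o \<Rightarrow> 'o"
  eval_arr :: "'o \<Rightarrow> 'o \<Rightarrow> 'm"
  curry_arr :: "'o \<Rightarrow> 'o \<Rightarrow> 'm \<Rightarrow> 'm"  (\<open>\<Lambda>\<index>\<close>)

definition hom :: "('o, 'm, 'x) cat_scheme \<Rightarrow> 'o \<Rightarrow> 'o \<Rightarrow> 'm set" where
  "hom C A B = {f \<in> Arr C. Dom C f = A \<and> Cod C f = B}"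

locale category =
  fixes C :: "('o, 'm, 'x) cat_scheme" (structure)
  assumes Dom_Obj: "f \<in> Arr C \<Longrightarrow> Dom C f \<in> Obj C"
    and Cod_Obj: "f \<in> Arr C \<Longrightarrow> Cod C f \<in> Obj C"
    and ident_hom: "A \<in> Obj C \<Longrightarrow> \<one> A \<in> hom C A A"
    and comp_hom: "\<lbrakk>f \<in> hom C X Y; g \<in> hom C Y Z\<rbrakk> \<Longrightarrow> g \<odot> f \<in> hom C X Z"
    and comp_ident_right: "f \<in> hom C X Y \<Longrightarrow> f \<odot> \<one> X = f"
    and comp_ident_left: "f \<in> hom C X Y \<Longrightarrow> \<one> Y \<odot> f = f"
    and comp_assoc: "\<lbrakk>f \<in> hom C W X; g \<in> hom C X Y; h \<in> hom C Y Z\<rbrakk>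
      \<Longrightarrow> (h \<odot> g) \<odot> f = h \<odot> (g \<odot> f)"

locale left_additive_category = category C
  for C :: "('o, 'm, 'x) la_cat_scheme" (structure) +
  assumes zero_hom: "\<lbrakk>A \<in> Obj C; B \<in> Obj C\<rbrakk> \<Longrightarrow> \<zero> A B \<in> hom C A B"
    and add_hom: "\<lbrakk>f \<in> hom C A B; g \<in> hom C A B\<rbrakk> \<Longrightarrow> f \<oplus> g \<in> hom C A B"
    and add_assoc: "\<lbrakk>f \<in> hom C A B; g \<in> hom C A B; h \<in> hom C A B\<rbrakk>
      \<Longrightarrow> (f \<oplus> g) \<oplus> h = f \<oplus> (g \<oplus> h)"
    and add_commute: "\<lbrakk>f \<in> hom C A B; g \<in> hom C A B\<rbrakk> \<Longrightarrow> f \<oplus> g = g \<oplus> f"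
    and add_zero: "f \<in> hom C A B \<Longrightarrow> f \<oplus> \<zero> A B = f"
    and add_comp: "\<lbrakk>f \<in> hom C X A; g \<in> hom C A B; h \<in> hom C A B\<rbrakk>
      \<Longrightarrow> (g \<oplus> h) \<odot> f = (g \<odot> f) \<oplus> (h \<odot> f)"
    and zero_comp: "\<lbrakk>f \<in> hom C X A; B \<in> Obj C\<rbrakk> \<Longrightarrow> \<zero> A B \<odot> f = \<zero> X B"

definition additive :: "('o, 'm, 'x) la_cat_scheme \<Rightarrow> 'm \<Rightarrow> bool" where
  "additive C f \<longleftrightarrow> f \<in> Arr C \<and>
    (\<forall>X \<in> Obj C.
      (\<forall>g \<in> hom C X (Dom C f). \<forall>h \<in> hom C X (Dom C f).
        f \<odot>\<^bsub>C\<^esub> (g \<oplus>\<^bsub>C\<^esub> h) = (f \<odot>\<^bsub>C\<^esub> g) \<oplus>\<^bsub>C\<^esub> (f \<odot>\<^bsub>C\<^esub> h)) \<and>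
      f \<odot>\<^bsub>C\<^esub> \<zero>\<^bsub>C\<^esub> X (Dom C f) = \<zero>\<^bsub>C\<^esub> X (Cod C f))"

locale cartesian_left_additive_category = left_additive_category C
  for C :: "('o, 'm, 'x) cla_cat_scheme" (structure) +
  assumes terminal_Obj: "\<top> \<in> Obj C"
    and terminal_unique: "A \<in> Obj C \<Longrightarrow> \<exists>!f. f \<in> hom C A \<top>"
    and prod_Obj: "\<lbrakk>A \<in> Obj C; B \<in> Obj C\<rbrakk> \<Longrightarrow> A \<otimes> B \<in> Obj C"
    and proj1_hom: "\<lbrakk>A \<in> Obj C; B \<in> Obj C\<rbrakk> \<Longrightarrow> \<pi>\<^sub>1 A B \<in> hom C (A \<otimes> B) A"
    and proj2_hom: "\<lbrakk>A \<in> Obj C; B \<in> Obj C\<rbrakk> \<Longrightarrow> \<pi>\<^sub>2 A B \<in> hom C (A \<otimes> B) B"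
    and pair_hom: "\<lbrakk>f \<in> hom C X A; g \<in> hom C X B\<rbrakk> \<Longrightarrow> \<langle>f, g\<rangle> \<in> hom C X (A \<otimes> B)"
    and proj1_pair: "\<lbrakk>f \<in> hom C X A; g \<in> hom C X B\<rbrakk> \<Longrightarrow> \<pi>\<^sub>1 A B \<odot> \<langle>f, g\<rangle> = f"
    and proj2_pair: "\<lbrakk>f \<in> hom C X A; g \<in> hom C X B\<rbrakk> \<Longrightarrow> \<pi>\<^sub>2 A B \<odot> \<langle>f, g\<rangle> = g"
    and pair_unique: "\<lbrakk>f \<in> hom C X A; g \<in> hom C X B; h \<in> hom C X (A \<otimes> B);
      \<pi>\<^sub>1 A B \<odot> h = f; \<pi>\<^sub>2 A B \<odot> h = g\<rbrakk> \<Longrightarrow> h = \<langle>f, g\<rangle>"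
    and proj1_additive: "\<lbrakk>A \<in> Obj C; B \<in> Obj C\<rbrakk> \<Longrightarrow> additive C (\<pi>\<^sub>1 A B)"
    and proj2_additive: "\<lbrakk>A \<in> Obj C; B \<in> Obj C\<rbrakk> \<Longrightarrow> additive C (\<pi>\<^sub>2 A B)"
    and pair_additive: "\<lbrakk>f \<in> hom C X A; g \<in> hom C X B; additive C f; additive C g\<rbrakk>
      \<Longrightarrow> additive C \<langle>f, g\<rangle>"

definition prod_arr :: "('o, 'm, 'x) cla_cat_scheme \<Rightarrow> 'm \<Rightarrow> 'm \<Rightarrow> 'm"
    (infixr \<open>\<boxtimes>\<index>\<close> 75) where
  "h \<boxtimes>\<^bsub>C\<^esub> k = \<langle>h \<odot>\<^bsub>C\<^esub> \<pi>\<^sub>1\<^bsub>C\<^esub> (Dom C h) (Dom C k), k \<odot>\<^bsub>C\<^esub> \<pi>\<^sub>2\<^bsub>C\<^esub> (Dom C h) (Dom C k)\<rangle>\<^bsub>C\<^esub>"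

locale cartesian_differential_category = cartesian_left_additive_category C
  for C :: "('o, 'm, 'x) cd_cat_scheme" (structure) +
  assumes diff_hom: "f \<in> hom C A B \<Longrightarrow> D f \<in> hom C (A \<otimes> A) B"
    and D1_add: "\<lbrakk>f \<in> hom C A B; g \<in> hom C A B\<rbrakk> \<Longrightarrow> D (f \<oplus> g) = D f \<oplus> D g"
    and D1_zero: "\<lbrakk>A \<in> Obj C; B \<in> Obj C\<rbrakk> \<Longrightarrow> D (\<zero> A B) = \<zero> (A \<otimes> A) B"
    and D2_add: "\<lbrakk>f \<in> hom C A B; h \<in> hom C X A; k \<in> hom C X A; v \<in> hom C X A\<rbrakk>
      \<Longrightarrow> D f \<odot> \<langle>h \<oplus> k, v\<rangle> = (D f \<odot> \<langle>h, v\<rangle>) \<oplus> (D f \<odot> \<langle>k, v\<rangle>)"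
    and D2_zero: "\<lbrakk>f \<in> hom C A B; v \<in> hom C X A\<rbrakk> \<Longrightarrow> D f \<odot> \<langle>\<zero> X A, v\<rangle> = \<zero> X B"
    and D3_ident: "A \<in> Obj C \<Longrightarrow> D (\<one> A) = \<pi>\<^sub>1 A A"
    and D3_proj1: "\<lbrakk>A \<in> Obj C; B \<in> Obj C\<rbrakk>
      \<Longrightarrow> D (\<pi>\<^sub>1 A B) = \<pi>\<^sub>1 A B \<odot> \<pi>\<^sub>1 (A \<otimes> B) (A \<otimes> B)"
    and D3_proj2: "\<lbrakk>A \<in> Obj C; B \<in> Obj C\<rbrakk>
      \<Longrightarrow> D (\<pi>\<^sub>2 A B) = \<pi>\<^sub>2 A B \<odot> \<pi>\<^sub>1 (A \<otimes> B) (A \<otimes> B)"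
    and D4: "\<lbrakk>f \<in> hom C X A; g \<in> hom C X B\<rbrakk> \<Longrightarrow> D \<langle>f, g\<rangle> = \<langle>D f, D g\<rangle>"
    and D5: "\<lbrakk>g \<in> hom C X Y; f \<in> hom C Y Z\<rbrakk>
      \<Longrightarrow> D (f \<odot> g) = D f \<odot> \<langle>D g, g \<odot> \<pi>\<^sub>2 X X\<rangle>"
    and D6: "\<lbrakk>f \<in> hom C A B; g \<in> hom C X A; h \<in> hom C X A; k \<in> hom C X A\<rbrakk>
      \<Longrightarrow> D (D f) \<odot> \<langle>\<langle>g, \<zero> X A\<rangle>, \<langle>h, k\<rangle>\<rangle> = D f \<odot> \<langle>g, k\<rangle>"
    and D7: "\<lbrakk>f \<in> hom C A B; g \<in> hom C X A; h \<in> hom C X A; k \<in> hom C X A\<rbrakk>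
      \<Longrightarrow> D (D f) \<odot> \<langle>\<langle>\<zero> X A, h\<rangle>, \<langle>g, k\<rangle>\<rangle> = D (D f) \<odot> \<langle>\<langle>\<zero> X A, g\<rangle>, \<langle>h, k\<rangle>\<rangle>"

locale cartesian_closed_differential_category = cartesian_differential_category C
  for C :: "('o, 'm, 'x) ccd_cat_scheme" (structure) +
  assumes exp_Obj: "\<lbrakk>A \<in> Obj C; B \<in> Obj C\<rbrakk> \<Longrightarrow> exp_obj C A B \<in> Obj C"
    and eval_hom: "\<lbrakk>A \<in> Obj C; B \<in> Obj C\<rbrakk>
      \<Longrightarrow> eval_arr C A B \<in> hom C (exp_obj C A B \<otimes> A) B"
    and curry_hom: "\<lbrakk>X \<in> Obj C; A \<in> Obj C; f \<in> hom C (X \<otimes> A) B\<rbrakk>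
      \<Longrightarrow> \<Lambda> X A f \<in> hom C X (exp_obj C A B)"
    and eval_curry: "\<lbrakk>X \<in> Obj C; A \<in> Obj C; f \<in> hom C (X \<otimes> A) B\<rbrakk>
      \<Longrightarrow> eval_arr C A B \<odot> (\<Lambda> X A f \<boxtimes> \<one> A) = f"
    and curry_unique: "\<lbrakk>X \<in> Obj C; A \<in> Obj C; B \<in> Obj C; f \<in> hom C (X \<otimes> A) B;
      h \<in> hom C X (exp_obj C A B); eval_arr C A B \<odot> (h \<boxtimes> \<one> A) = f\<rbrakk> \<Longrightarrow> h = \<Lambda> X A f"
    and curry_add: "\<lbrakk>X \<in> Obj C; A \<in> Obj C; f \<in> hom C (X \<otimes> A) B; g \<in> hom C (X \<otimes> A) B\<rbrakk>
      \<Longrightarrow> \<Lambda> X A (f \<oplus> g) = \<Lambda> X A f \<oplus> \<Lambda> X A g"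
    and curry_zero: "\<lbrakk>X \<in> Obj C; A \<in> Obj C; B \<in> Obj C\<rbrakk>
      \<Longrightarrow> \<Lambda> X A (\<zero> (X \<otimes> A) B) = \<zero> X (exp_obj C A B)"
    and diff_curry: "\<lbrakk>X \<in> Obj C; A \<in> Obj C; f \<in> hom C (X \<otimes> A) B\<rbrakk>
      \<Longrightarrow> D (\<Lambda> X A f) =
        \<Lambda> (X \<otimes> X) A (D f \<odot> \<langle>\<pi>\<^sub>1 X X \<boxtimes> \<zero> A A, \<pi>\<^sub>2 X X \<boxtimes> \<one> A\<rangle>)"

text \<open>\<open>uncurry_arr C A B h\<close> is \<open>\<Lambda>\<^sup>-(h)\<close> for \<open>h : X \<rightarrow> [A \<Rightarrow> B]\<close>.\<close>

definition uncurry_arr :: "('o, 'm, 'x) ccd_cat_scheme \<Rightarrow> 'o \<Rightarrow> 'o \<Rightarrow> 'm \<Rightarrow> 'm" where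
  "uncurry_arr C A B h = eval_arr C A B \<odot>\<^bsub>C\<^esub> (h \<boxtimes>\<^bsub>C\<^esub> \<one>\<^bsub>C\<^esub> A)"

definition linear_arr :: "('o, 'm, 'x) cd_cat_scheme \<Rightarrow> 'm \<Rightarrow> bool" where
  "linear_arr C f \<longleftrightarrow> f \<in> Arr C \<and> D\<^bsub>C\<^esub> f = f \<odot>\<^bsub>C\<^esub> \<pi>\<^sub>1\<^bsub>C\<^esub> (Dom C f) (Dom C f)"

text \<open>For \<open>f : X \<otimes> A \<rightarrow> B\<close> and \<open>g : X \<rightarrow> A\<close>, the objects \<open>X\<close> and \<open>A\<close> are read off from \<open>g\<close>.\<close>

definition star :: "('o, 'm, 'x) cd_cat_scheme \<Rightarrow> 'm \<Rightarrow> 'm \<Rightarrow> 'm"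
    (infixl \<open>\<star>\<index>\<close> 70) where
  "f \<star>\<^bsub>C\<^esub> g = (let X = Dom C g; A = Cod C g in
     D\<^bsub>C\<^esub> f \<odot>\<^bsub>C\<^esub>
       \<langle>\<langle>\<zero>\<^bsub>C\<^esub> (X \<otimes>\<^bsub>C\<^esub> A) X, g \<odot>\<^bsub>C\<^esub> \<pi>\<^sub>1\<^bsub>C\<^esub> X A\<rangle>\<^bsub>C\<^esub>, \<one>\<^bsub>C\<^esub> (X \<otimes>\<^bsub>C\<^esub> A)\<rangle>\<^bsub>C\<^esub>)"

definition linear_reflexive_object ::
    "('o, 'm, 'x) ccd_cat_scheme \<Rightarrow> 'o \<Rightarrow> 'm \<Rightarrow> 'm \<Rightarrow> bool" where
  "linear_reflexive_object C U \<A> \<l> \<longleftrightarrow>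
     U \<in> Obj C \<and> \<A> \<in> hom C U (exp_obj C U U) \<and> \<l> \<in> hom C (exp_obj C U U) U \<and>
     \<A> \<odot>\<^bsub>C\<^esub> \<l> = \<one>\<^bsub>C\<^esub> (exp_obj C U U) \<and> linear_arr C \<A> \<and> linear_arr C \<l>"


section \<open>Differential lambda-terms\<close>

text \<open>Variables are the natural numbers. Terms up to alpha-conversion are represented by de Bruijn
  terms: below \<open>k\<close> binders the variable \<open>y\<close> occurs as the index \<open>y + k\<close>; the named abstraction
  is \<open>lam\<close> below. A sum of simple terms is a list: \<open>0\<close> is \<open>[]\<close>, the simple term \<open>s\<close> is \<open>[s]\<close>,
  \<open>s + T\<close> is \<open>s # T\<close>, and \<open>S + T\<close> is \<open>S @ T\<close>.\<close>

datatype simple =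
    Var nat
  | Lam simple
  | App simple "simple list"
  | Dif simple simple

type_synonym dterm = "simple list"

fun FV :: "simple \<Rightarrow> nat set" where
  "FV (Var y) = {y}"
| "FV (Lam s) = {y. Suc y \<in> FV s}"
| "FV (App s T) = FV s \<union> (\<Union>t \<in> set T. FV t)"
| "FV (Dif s t) = FV s \<union> FV t"

definition FVs :: "dterm \<Rightarrow> nat set" where
  "FVs S = (\<Union>s \<in> set S. FV s)"

definition up :: "(nat \<Rightarrow> nat) \<Rightarrow> nat \<Rightarrow> nat" where
  "up r n = (case n of 0 \<Rightarrow> 0 | Suc m \<Rightarrow> Suc (r m))"

fun rename :: "(nat \<Rightarrow> nat) \<Rightarrow> simple \<Rightarrow> simple" where
  "rename r (Var y) = Var (r y)"
| "rename r (Lam s) = Lam (rename (up r) s)"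
| "rename r (App s T) = App (rename r s) (map (rename r) T)"
| "rename r (Dif s t) = Dif (rename r s) (rename r t)"

definition bind :: "nat \<Rightarrow> nat \<Rightarrow> nat" where
  "bind x y = (if y = x then 0 else Suc y)"

text \<open>\<open>lam x s\<close> is \<open>\<lambda>x. s\<close>; see \<open>FV_lam\<close>, \<open>lam_alpha\<close> and \<open>Lam_eq_lam\<close>.\<close>

definition lam :: "nat \<Rightarrow> simple \<Rightarrow> simple" where
  "lam x s = Lam (rename (bind x) s)"

text \<open>The constructors extended to sums by (bi)linearity.\<close>

definition lams :: "nat \<Rightarrow> dterm \<Rightarrow> dterm" where
  "lams x S = map (lam x) S"

definition apps :: "dterm \<Rightarrow> dterm \<Rightarrow> dterm" where
  "apps S T = map (\<lambda>s. App s T) S"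

definition difs :: "dterm \<Rightarrow> dterm \<Rightarrow> dterm" where
  "difs S T = concat (map (\<lambda>s. map (Dif s) T) S)"

text \<open>\<open>Difn s [t\<^sub>1, \<dots>, t\<^sub>n]\<close> is the iterated \<open>D\<^sup>n s \<cdot> (t\<^sub>1, \<dots>, t\<^sub>n)\<close>.\<close>

fun Difn :: "simple \<Rightarrow> simple list \<Rightarrow> simple" where
  "Difn s [] = s"
| "Difn s (t # ts) = Difn (Dif s t) ts"

text \<open>The identifications on terms beyond alpha-conversion and the list encoding of sums: the least
  congruence containing permutative equality and commutativity of sums.\<close>

inductive simple_eq :: "simple \<Rightarrow> simple \<Rightarrow> bool"
  and dterm_eq :: "dterm \<Rightarrow> dterm \<Rightarrow> bool" where
  seq_refl: "simple_eq s s"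
| seq_sym: "simple_eq s t \<Longrightarrow> simple_eq t s"
| seq_trans: "simple_eq s t \<Longrightarrow> simple_eq t u \<Longrightarrow> simple_eq s u"
| seq_Lam: "simple_eq s s' \<Longrightarrow> simple_eq (Lam s) (Lam s')"
| seq_App: "simple_eq s s' \<Longrightarrow> dterm_eq T T' \<Longrightarrow> simple_eq (App s T) (App s' T')"
| seq_Dif: "simple_eq s s' \<Longrightarrow> simple_eq t t' \<Longrightarrow> simple_eq (Dif s t) (Dif s' t')"
| seq_perm: "mset ts = mset us \<Longrightarrow> simple_eq (Difn s ts) (Difn s us)"
| teq_Nil: "dterm_eq [] []"
| teq_Cons: "simple_eq s s' \<Longrightarrow> dterm_eq T T' \<Longrightarrow> dterm_eq (s # T) (s' # T')"
| teq_comm: "mset S = mset T \<Longrightarrow> dterm_eq S T"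
| teq_sym: "dterm_eq S T \<Longrightarrow> dterm_eq T S"
| teq_trans: "dterm_eq S T \<Longrightarrow> dterm_eq T V \<Longrightarrow> dterm_eq S V"

text \<open>\<open>subst s x T\<close> is \<open>s{T/x}\<close>, and \<open>dsubst s x T\<close> is \<open>\<partial>s/\<partial>x \<cdot> T\<close>. In the latter the clause for
  \<open>Dif\<close> yields the one for \<open>Difn\<close>, see \<open>dsubst_Difn\<close>.\<close>

fun subst :: "simple \<Rightarrow> nat \<Rightarrow> dterm \<Rightarrow> dterm" where
  "subst (Var y) x T = (if y = x then T else [Var y])"
| "subst (Lam s) x T = map Lam (subst s (Suc x) (map (rename Suc) T))"
| "subst (App s V) x T = apps (subst s x T) (concat (map (\<lambda>v. subst v x T) V))"
| "subst (Dif s u) x T = difs (subst s x T) (subst u x T)"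

fun dsubst :: "simple \<Rightarrow> nat \<Rightarrow> dterm \<Rightarrow> dterm" where
  "dsubst (Var y) x T = (if y = x then T else [])"
| "dsubst (Lam s) x T = map Lam (dsubst s (Suc x) (map (rename Suc) T))"
| "dsubst (App s V) x T =
     apps (dsubst s x T) V @ apps (difs [s] (concat (map (\<lambda>v. dsubst v x T) V))) V"
| "dsubst (Dif s u) x T = difs (dsubst s x T) [u] @ difs [s] (dsubst u x T)"

text \<open>An equation \<open>S = T\<close> between classes of terms is a pair \<open>(S, T)\<close> of representatives, hence
  the inclusion of \<open>dterm_eq\<close>. The side condition \<open>x \<notin> FV t\<close> in the last clause is the usual
  variable convention: otherwise \<open>\<lambda>x\<close> would capture \<open>x\<close> in \<open>t\<close>.\<close>

definition differential_lambda_theory :: "(dterm \<times> dterm) set \<Rightarrow> bool" where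
  "differential_lambda_theory R \<longleftrightarrow>
     equiv UNIV R \<and>
     (\<forall>S T. dterm_eq S T \<longrightarrow> (S, T) \<in> R) \<and>
     (\<forall>x s S. ([s], S) \<in> R \<longrightarrow> ([lam x s], lams x S) \<in> R) \<and>
     (\<forall>s S T V. ([s], S) \<in> R \<longrightarrow> (T, V) \<in> R \<longrightarrow> ([App s T], apps S V) \<in> R) \<and>
     (\<forall>s S u V. ([s], S) \<in> R \<longrightarrow> ([u], V) \<in> R \<longrightarrow> ([Dif s u], difs S V) \<in> R) \<and>
     (\<forall>ss Ss. list_all2 (\<lambda>s S. ([s], S) \<in> R) ss Ss \<longrightarrow> (ss, concat Ss) \<in> R) \<and>
     (\<forall>x s T. ([App (lam x s) T], subst s x T) \<in> R) \<and>
     (\<forall>x s t. x \<notin> FV t \<longrightarrow> ([Dif (lam x s) t], lams x (dsubst s x [t])) \<in> R)"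


section \<open>Interpretation\<close>

text \<open>A sequence \<open>x\<^sub>1, \<dots>, x\<^sub>n\<close> of variables is represented by the reversed list
  \<open>[x\<^sub>n, \<dots>, x\<^sub>1]\<close>, so that its extension by \<open>z\<close> is \<open>z # xs\<close>.\<close>

context
  fixes C :: "('o, 'm, 'x) ccd_cat_scheme" (structure)
    and U :: 'o and \<A> \<l> :: 'm
begin

fun ctx_obj :: "nat list \<Rightarrow> 'o" where
  "ctx_obj [] = \<top>"
| "ctx_obj (x # xs) = ctx_obj xs \<otimes> U"

fun ctx_proj :: "nat list \<Rightarrow> nat \<Rightarrow> 'm" where
  "ctx_proj [] y = undefined"
| "ctx_proj (x # xs) y =
     (if y = x then \<pi>\<^sub>2 (ctx_obj xs) U else ctx_proj xs y \<odot> \<pi>\<^sub>1 (ctx_obj xs) U)"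

text \<open>Below a binder the variables \<open>xs\<close> have the indices \<open>map Suc xs\<close> and the bound variable
  the index \<open>0\<close>; the clause for a named abstraction is \<open>interp_lam\<close>.\<close>

fun interp :: "simple \<Rightarrow> nat list \<Rightarrow> 'm" where
  "interp (Var y) xs = ctx_proj xs y"
| "interp (Lam s) xs = \<l> \<odot> \<Lambda> (ctx_obj xs) U (interp s (0 # map Suc xs))"
| "interp (App s T) xs = eval_arr C U U \<odot>
     \<langle>\<A> \<odot> interp s xs,
      foldr (\<oplus>) (map (\<lambda>t. interp t xs) T) (\<zero> (ctx_obj xs) U)\<rangle>"
| "interp (Dif s t) xs =
     \<l> \<odot> \<Lambda> (ctx_obj xs) U (uncurry_arr C U U (\<A> \<odot> interp s xs) \<star> interp t xs)"

definition interps :: "dterm \<Rightarrow> nat list \<Rightarrow> 'm" where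
  "interps S xs = foldr (\<oplus>) (map (\<lambda>s. interp s xs) S) (\<zero> (ctx_obj xs) U)"

definition Th :: "(dterm \<times> dterm) set" where
  "Th = {(S, T). \<exists>xs. distinct xs \<and> FVs S \<subseteq> set xs \<and> FVs T \<subseteq> set xs \<and>
     interps S xs = interps T xs}"

end


section \<open>The named presentation\<close>

lemma up_simps [simp]: "up r 0 = 0" "up r (Suc n) = Suc (r n)"
  by (simp_all add: up_def)

lemma up_comp: "up r \<circ> up q = up (r \<circ> q)"
  by (rule ext) (simp add: up_def split: nat.split)

lemma inj_up:
  assumes "inj r"
  shows "inj (up r)"
proof (rule injI)
  fix x y assume "up r x = up r y"
  then show "x = y" by (cases x; cases y) (simp_all add: inj_eq[OF assms])
qed

lemma inj_bind: "inj (bind x)"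
  by (rule injI) (simp add: bind_def split: if_splits)

lemma rename_cong: "(\<And>y. y \<in> FV s \<Longrightarrow> r y = q y) \<Longrightarrow> rename r s = rename q s"
proof (induction s arbitrary: r q)
  case (Lam s)
  have "rename (up r) s = rename (up q) s"
  proof (rule Lam.IH)
    fix y assume "y \<in> FV s"
    then show "up r y = up q y" using Lam.prems by (cases y) simp_all
  qed
  then show ?case by simp
next
  case (App s T)
  have "rename r s = rename q s"
    by (rule App.IH(1)) (simp add: App.prems)
  moreover have "rename r t = rename q t" if "t \<in> set T" for t
  proof (rule App.IH(2)[OF that])
    fix y assume "y \<in> FV t"
    with that have "y \<in> FV (App s T)" by auto
    then show "r y = q y" by (rule App.prems)
  qed
  ultimately show ?case by simp
next
  case (Dif s t)
  have "rename r s = rename q s"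
    by (rule Dif.IH(1)) (simp add: Dif.prems)
  moreover have "rename r t = rename q t"
    by (rule Dif.IH(2)) (simp add: Dif.prems)
  ultimately show ?case by simp
qed simp

lemma rename_rename: "rename r (rename q s) = rename (r \<circ> q) s"
  by (induction s arbitrary: r q) (simp_all add: up_comp)

lemma rename_id: "rename id s = s"
proof (induction s)
  case (Lam s)
  have "up id = id" by (rule ext) (simp add: up_def split: nat.split)
  with Lam show ?case by (simp only: rename.simps)
qed (simp_all add: map_idI)

lemma FV_rename: "FV (rename r s) = r ` FV s"
proof (induction s arbitrary: r)
  case (Lam s)
  show ?case
  proof (intro equalityI subsetI)
    fix y assume "y \<in> FV (rename r (Lam s))"
    then obtain z where "z \<in> FV s" "Suc y = up r z" using Lam.IH by auto
    then show "y \<in> r ` FV (Lam s)" by (cases z) auto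
  next
    fix y assume "y \<in> r ` FV (Lam s)"
    then obtain z where "Suc z \<in> FV s" "y = r z" by auto
    then show "y \<in> FV (rename r (Lam s))"
      using Lam.IH by (auto intro!: image_eqI[of _ _ "Suc z"])
  qed
qed auto

lemma FV_lam: "FV (lam x s) = FV s - {x}"
  by (auto simp: lam_def FV_rename bind_def image_iff split: if_splits)

lemma lam_alpha:
  assumes "y \<notin> FV s - {x}"
  shows "lam x s = lam y (rename (id(x := y)) s)"
  unfolding lam_def rename_rename
  using assms by (auto simp: bind_def intro!: rename_cong)

lemma Lam_eq_lam:
  assumes "x \<notin> FV (Lam s)"
  shows "Lam s = lam x (rename (case_nat x id) s)"
proof -
  have "rename (bind x \<circ> case_nat x id) s = rename id s"
    using assms by (intro rename_cong) (auto simp: bind_def split: nat.splits)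
  then show ?thesis by (simp add: lam_def rename_rename rename_id)
qed

lemma map_rename_apps: "map (rename r) (apps S T) = apps (map (rename r) S) (map (rename r) T)"
  by (simp add: apps_def)

lemma map_rename_difs: "map (rename r) (difs S T) = difs (map (rename r) S) (map (rename r) T)"
  by (simp add: difs_def map_concat comp_def)

lemma map_rename_shift: "map (rename (up r)) (map (rename Suc) T) = map (rename Suc) (map (rename r) T)"
proof -
  have "up r \<circ> Suc = Suc \<circ> r" by auto
  then show ?thesis by (simp add: rename_rename)
qed

lemma rename_subst:
  "inj r \<Longrightarrow> map (rename r) (subst s x T) = subst (rename r s) (r x) (map (rename r) T)"
proof (induction s arbitrary: r x T)
  case (Lam s)
  from Lam.IH[OF inj_up[OF Lam.prems], of "Suc x" "map (rename Suc) T"]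
  have "map (rename (up r)) (subst s (Suc x) (map (rename Suc) T)) =
      subst (rename (up r) s) (Suc (r x)) (map (rename Suc) (map (rename r) T))"
    by (simp only: map_rename_shift up_simps)
  then have "map Lam (map (rename (up r)) (subst s (Suc x) (map (rename Suc) T))) =
      map Lam (subst (rename (up r) s) (Suc (r x)) (map (rename Suc) (map (rename r) T)))"
    by (rule arg_cong)
  then show ?case by (simp add: comp_def)
next
  case (App s V)
  then show ?case
    by (simp add: map_rename_apps map_concat comp_def cong: map_cong)
qed (auto simp: map_rename_difs inj_eq)

lemma rename_dsubst:
  "inj r \<Longrightarrow> map (rename r) (dsubst s x T) = dsubst (rename r s) (r x) (map (rename r) T)"
proof (induction s arbitrary: r x T)
  case (Lam s)
  from Lam.IH[OF inj_up[OF Lam.prems], of "Suc x" "map (rename Suc) T"]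
  have "map (rename (up r)) (dsubst s (Suc x) (map (rename Suc) T)) =
      dsubst (rename (up r) s) (Suc (r x)) (map (rename Suc) (map (rename r) T))"
    by (simp only: map_rename_shift up_simps)
  then have "map Lam (map (rename (up r)) (dsubst s (Suc x) (map (rename Suc) T))) =
      map Lam (dsubst (rename (up r) s) (Suc (r x)) (map (rename Suc) (map (rename r) T)))"
    by (rule arg_cong)
  then show ?case by (simp add: comp_def)
next
  case (App s V)
  then show ?case
    by (simp add: map_rename_apps map_rename_difs map_concat comp_def cong: map_cong)
qed (auto simp: map_rename_difs inj_eq)

lemma map_rename_bind_fresh:
  "y \<notin> FVs T \<Longrightarrow> map (rename (bind y)) T = map (rename Suc) T"
  by (auto simp: FVs_def bind_def intro!: rename_cong)

lemma subst_lam: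
  assumes "y \<noteq> x" "y \<notin> FVs T"
  shows "subst (lam y s) x T = lams y (subst s x T)"
proof -
  have "subst (rename (bind y) s) (bind y x) (map (rename (bind y)) T) =
      map (rename (bind y)) (subst s x T)"
    by (rule rename_subst[symmetric]) (rule inj_bind)
  with assms show ?thesis
    by (simp add: lam_def[abs_def] lams_def map_rename_bind_fresh bind_def[of y x] comp_def)
qed

lemma dsubst_lam:
  assumes "y \<noteq> x" "y \<notin> FVs T"
  shows "dsubst (lam y s) x T = lams y (dsubst s x T)"
proof -
  have "dsubst (rename (bind y) s) (bind y x) (map (rename (bind y)) T) =
      map (rename (bind y)) (dsubst s x T)"
    by (rule rename_dsubst[symmetric]) (rule inj_bind)
  with assms show ?thesis
    by (simp add: lam_def[abs_def] lams_def map_rename_bind_fresh bind_def[of y x] comp_def)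
qed

lemma Difn_snoc: "Difn s (us @ [u]) = Dif (Difn s us) u"
  by (induction us arbitrary: s) simp_all

lemma dsubst_Difn:
  "dsubst (Difn s us) x T = map (\<lambda>s'. Difn s' us) (dsubst s x T) @
     concat (map (\<lambda>i. map (\<lambda>u. Difn s (us[i := u])) (dsubst (us ! i) x T)) [0..<length us])"
proof (induction us rule: rev_induct)
  case Nil
  show ?case by simp
next
  case (snoc u us)
  have *: "map (\<lambda>i. map (\<lambda>v. Difn s ((us @ [u])[i := v])) (dsubst ((us @ [u]) ! i) x T)) [0..<length us] =
      map (\<lambda>i. map (\<lambda>v. Dif (Difn s (us[i := v])) u) (dsubst (us ! i) x T)) [0..<length us]"
    by (rule map_cong) (simp_all add: nth_append list_update_append Difn_snoc)
  have **: "difs S [u] = map (\<lambda>s. Dif s u) S" for S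
    by (induction S) (simp_all add: difs_def)
  have ***: "difs [s] S = map (Dif s) S" for s S
    by (simp add: difs_def)
  show ?case
    by (simp add: Difn_snoc * ** *** snoc.IH map_concat comp_def)
qed

lemma ctx_obj_map: "ctx_obj C U (map r xs) = ctx_obj C U xs"
  by (induction xs) simp_all

lemma ctx_proj_map: "inj r \<Longrightarrow> ctx_proj C U (map r xs) (r y) = ctx_proj C U xs y"
  by (induction xs) (auto simp: inj_eq ctx_obj_map)

lemma interp_rename:
  "inj r \<Longrightarrow> interp C U \<A> \<l> (rename r s) (map r xs) = interp C U \<A> \<l> s xs"
proof (induction s arbitrary: r xs)
  case (Lam s)
  have "0 # map Suc (map r xs) = map (up r) (0 # map Suc xs)" by simp
  with Lam.IH[OF inj_up[OF Lam.prems], of "0 # map Suc xs"]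
  have "interp C U \<A> \<l> (rename (up r) s) (0 # map Suc (map r xs)) =
      interp C U \<A> \<l> s (0 # map Suc xs)" by (simp only:)
  then show ?case by (simp only: rename.simps interp.simps ctx_obj_map)
next
  case (App s T)
  then show ?case
    by (simp add: ctx_obj_map comp_def cong: map_cong)
qed (simp_all add: ctx_proj_map ctx_obj_map)

lemma interp_lam:
  assumes "z \<notin> set xs"
  shows "interp C U \<A> \<l> (lam z s) xs =
    \<l> \<odot>\<^bsub>C\<^esub> \<Lambda>\<^bsub>C\<^esub> (ctx_obj C U xs) U (interp C U \<A> \<l> s (z # xs))"
proof -
  have "map (bind z) (z # xs) = 0 # map Suc xs"
    using assms by (auto simp: bind_def)
  with interp_rename[OF inj_bind, of C U \<A> \<l> z s "z # xs"] show ?thesis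
    by (simp only: lam_def interp.simps)
qed

end

theory Submission
  imports Defs
begin

text \<open>Every term former becomes an operation on arrows into \<open>U\<close> that is natural in the context and
  whose derivative obeys the Leibniz rule matching the clause of differential substitution for it.
  Hence, by induction on terms, substitution is interpreted by composition with a morphism of
  contexts, and differential substitution by the directional derivative
  \<open>D \<lbrakk>s\<rbrakk> \<circ> \<langle>d, 1\<rangle>\<close>, where the direction \<open>d\<close> has component \<open>\<lbrakk>T\<rbrakk>\<close> at \<open>x\<close> and \<open>0\<close> elsewhere.
  Together with \<open>\<A> \<circ> \<l> = 1\<close> these give \<open>(\<beta>)\<close> and \<open>(\<beta>\<^sub>D)\<close>. Linearity of \<open>\<A>\<close> and \<open>\<l>\<close> makes the
  operations additive, and the symmetry (D7) of second derivatives makes iterated differential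
  applications permutable. A context may contain a shadowed variable, so no freshness is needed for
  abstraction.\<close>

section \<open>Arrow calculus\<close>

context category
begin

lemma hom_iff: "f \<in> hom C X Y \<longleftrightarrow> f \<in> Arr C \<and> Dom C f = X \<and> Cod C f = Y"
  by (simp add: hom_def)

lemma in_hom: "f \<in> Arr C \<Longrightarrow> f \<in> hom C (Dom C f) (Cod C f)"
  by (simp add: hom_def)

text \<open>The axioms speak of \<open>hom\<close>, whose objects a rewrite rule cannot guess. Here
  and below they are restated with conditions on \<open>Arr\<close>, \<open>Dom\<close> and
  \<open>Cod\<close>, which simplification can check by itself.\<close>

lemma ident_arr [simp]:
  assumes "A \<in> Obj C"
  shows "\<one> A \<in> Arr C" "Dom C (\<one> A) = A" "Cod C (\<one> A) = A"
  using ident_hom[OF assms] by (simp_all add: hom_def)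

lemma comp_arr [simp]:
  assumes "f \<in> Arr C" "g \<in> Arr C" "Cod C f = Dom C g"
  shows "g \<odot> f \<in> Arr C" "Dom C (g \<odot> f) = Dom C f" "Cod C (g \<odot> f) = Cod C g"
  using comp_hom[of f "Dom C f" "Dom C g" g "Cod C g"] assms by (simp_all add: hom_def)

lemma comp_ident [simp]:
  assumes "f \<in> Arr C"
  shows "X = Dom C f \<Longrightarrow> f \<odot> \<one> X = f" "Y = Cod C f \<Longrightarrow> \<one> Y \<odot> f = f"
  using comp_ident_right[OF in_hom] comp_ident_left[OF in_hom] assms by simp_all

lemma assoc [simp]:
  assumes "f \<in> Arr C" "g \<in> Arr C" "h \<in> Arr C" "Cod C f = Dom C g" "Cod C g = Dom C h"
  shows "(h \<odot> g) \<odot> f = h \<odot> (g \<odot> f)"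
  using comp_assoc[of f "Dom C f" "Dom C g" g "Dom C h" h "Cod C h"] assms by (simp add: hom_def)

text \<open>Composites are normalised to nest to the right, where an equation for
  \<open>g \<odot> f\<close> no longer matches; this form applies it there.\<close>

lemma comp_reassoc:
  assumes "g \<odot> f = k" "f \<in> Arr C" "g \<in> Arr C" "h \<in> Arr C" "Cod C h = Dom C f" "Cod C f = Dom C g"
  shows "g \<odot> (f \<odot> h) = k \<odot> h"
  using assms(2-) by (simp flip: assms(1))

end

context left_additive_category
begin

lemma zero_arr [simp]:
  assumes "A \<in> Obj C" "B \<in> Obj C"
  shows "\<zero> A B \<in> Arr C" "Dom C (\<zero> A B) = A" "Cod C (\<zero> A B) = B"
  using zero_hom[OF assms] by (simp_all add: hom_def)

lemma add_arr [simp]: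
  assumes "f \<in> Arr C" "g \<in> Arr C" "Dom C f = Dom C g" "Cod C f = Cod C g"
  shows "f \<oplus> g \<in> Arr C" "Dom C (f \<oplus> g) = Dom C g" "Cod C (f \<oplus> g) = Cod C g"
  using add_hom[of f "Dom C g" "Cod C g" g] assms by (simp_all add: hom_def)

lemma plus_assoc:
  assumes "f \<in> Arr C" "g \<in> Arr C" "h \<in> Arr C" "Dom C f = Dom C g" "Cod C f = Cod C g"
    "Dom C g = Dom C h" "Cod C g = Cod C h"
  shows "(f \<oplus> g) \<oplus> h = f \<oplus> (g \<oplus> h)"
  using add_assoc[of f "Dom C h" "Cod C h" g h] assms by (simp add: hom_def)

lemma plus_commute:
  assumes "f \<in> Arr C" "g \<in> Arr C" "Dom C f = Dom C g" "Cod C f = Cod C g"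
  shows "f \<oplus> g = g \<oplus> f"
  using add_commute[of f "Dom C g" "Cod C g" g] assms by (simp add: hom_def)

lemma plus_zero [simp]:
  assumes "f \<in> Arr C" "Dom C f = A" "Cod C f = B"
  shows "f \<oplus> \<zero> A B = f" "\<zero> A B \<oplus> f = f"
proof -
  show *: "f \<oplus> \<zero> A B = f"
    using add_zero[of f A B] assms by (simp add: hom_def)
  have "A \<in> Obj C" "B \<in> Obj C"
    using assms Dom_Obj Cod_Obj by auto
  then show "\<zero> A B \<oplus> f = f"
    using plus_commute[of "\<zero> A B" f] assms * by simp
qed

lemma plus_comp [simp]:
  assumes "f \<in> Arr C" "g \<in> Arr C" "h \<in> Arr C" "Cod C f = Dom C g" "Dom C g = Dom C h"
    "Cod C g = Cod C h"
  shows "(g \<oplus> h) \<odot> f = (g \<odot> f) \<oplus> (h \<odot> f)"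
  using add_comp[of f "Dom C f" "Dom C h" g "Cod C h" h] assms by (simp add: hom_def)

lemma zero_comp' [simp]:
  assumes "f \<in> Arr C" "Cod C f = A" "B \<in> Obj C"
  shows "\<zero> A B \<odot> f = \<zero> (Dom C f) B"
  using zero_comp[of f "Dom C f" A B] assms by (simp add: hom_def)

end

section \<open>Finite products and componentwise addition\<close>

context cartesian_left_additive_category
begin

lemmas [simp] = terminal_Obj prod_Obj

lemma proj_arr [simp]:
  assumes "A \<in> Obj C" "B \<in> Obj C"
  shows "\<pi>\<^sub>1 A B \<in> Arr C" "Dom C (\<pi>\<^sub>1 A B) = A \<otimes> B" "Cod C (\<pi>\<^sub>1 A B) = A"
    "\<pi>\<^sub>2 A B \<in> Arr C" "Dom C (\<pi>\<^sub>2 A B) = A \<otimes> B" "Cod C (\<pi>\<^sub>2 A B) = B"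
  using proj1_hom[OF assms] proj2_hom[OF assms] by (simp_all add: hom_def)

lemma pair_arr [simp]:
  assumes "f \<in> Arr C" "g \<in> Arr C" "Dom C f = Dom C g"
  shows "\<langle>f, g\<rangle> \<in> Arr C" "Dom C \<langle>f, g\<rangle> = Dom C g" "Cod C \<langle>f, g\<rangle> = Cod C f \<otimes> Cod C g"
  using pair_hom[of f "Dom C g" "Cod C f" g "Cod C g"] assms by (simp_all add: hom_def)

lemma proj_pair [simp]:
  assumes "f \<in> Arr C" "g \<in> Arr C" "Dom C f = Dom C g" "Cod C f = A" "Cod C g = B"
  shows "\<pi>\<^sub>1 A B \<odot> \<langle>f, g\<rangle> = f" "\<pi>\<^sub>2 A B \<odot> \<langle>f, g\<rangle> = g"
  using proj1_pair[of f "Dom C g" A g B] proj2_pair[of f "Dom C g" A g B] assms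
  by (simp_all add: hom_def)

lemma pair_eqI:
  assumes "h \<in> Arr C" "Cod C h = A \<otimes> B" "A \<in> Obj C" "B \<in> Obj C"
    "\<pi>\<^sub>1 A B \<odot> h = f" "\<pi>\<^sub>2 A B \<odot> h = g"
  shows "h = \<langle>f, g\<rangle>"
proof (rule pair_unique)
  show "f \<in> hom C (Dom C h) A" "g \<in> hom C (Dom C h) B" "h \<in> hom C (Dom C h) (A \<otimes> B)"
    using assms(1-4) by (simp_all add: hom_def flip: assms(5,6))
qed (use assms in auto)

lemma pair_eta [simp]:
  assumes "h \<in> Arr C" "Cod C h = A \<otimes> B" "A \<in> Obj C" "B \<in> Obj C"
  shows "\<langle>\<pi>\<^sub>1 A B \<odot> h, \<pi>\<^sub>2 A B \<odot> h\<rangle> = h"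
  by (rule pair_eqI[of _ A B, symmetric]) (use assms in simp_all)

lemma pair_proj [simp]:
  assumes "A \<in> Obj C" "B \<in> Obj C"
  shows "\<langle>\<pi>\<^sub>1 A B, \<pi>\<^sub>2 A B\<rangle> = \<one> (A \<otimes> B)"
  by (rule pair_eqI[of _ A B, symmetric]) (use assms in simp_all)

lemma pair_comp [simp]:
  assumes "f \<in> Arr C" "g \<in> Arr C" "h \<in> Arr C" "Dom C f = Dom C g" "Cod C h = Dom C g"
  shows "\<langle>f, g\<rangle> \<odot> h = \<langle>f \<odot> h, g \<odot> h\<rangle>"
proof (rule pair_eqI)
  have "Cod C f \<in> Obj C" "Cod C g \<in> Obj C"
    using assms Cod_Obj by auto
  then show "\<pi>\<^sub>1 (Cod C f) (Cod C g) \<odot> \<langle>f, g\<rangle> \<odot> h = f \<odot> h"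
    "\<pi>\<^sub>2 (Cod C f) (Cod C g) \<odot> \<langle>f, g\<rangle> \<odot> h = g \<odot> h"
    using assms by (simp_all flip: assoc)
qed (use assms Cod_Obj in simp_all)

lemma additive_add [simp]:
  assumes "additive C f" "g \<in> Arr C" "h \<in> Arr C" "Dom C g = Dom C h" "Cod C g = Dom C f"
    "Cod C h = Dom C f"
  shows "f \<odot> (g \<oplus> h) = (f \<odot> g) \<oplus> (f \<odot> h)"
  using assms Dom_Obj[of h] unfolding additive_def by (auto simp: hom_def)

lemma additive_zero [simp]:
  assumes "additive C f" "X \<in> Obj C" "A = Dom C f"
  shows "f \<odot> \<zero> X A = \<zero> X (Cod C f)"
  using assms unfolding additive_def by simp

lemmas [simp] = proj1_additive proj2_additive

lemma pair_zero [simp]: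
  assumes "X \<in> Obj C" "A \<in> Obj C" "B \<in> Obj C"
  shows "\<langle>\<zero> X A, \<zero> X B\<rangle> = \<zero> X (A \<otimes> B)"
  by (rule pair_eqI[of _ A B, symmetric]) (use assms in simp_all)

text \<open>The projections are additive, so both sides have the same components. This is how a
  direction of differentiation is split into summands, to which (D2) then applies.\<close>

lemma pair_plus:
  assumes "f \<in> Arr C" "g \<in> Arr C" "f' \<in> Arr C" "g' \<in> Arr C" "Dom C f = X" "Dom C g = X"
    "Dom C f' = X" "Dom C g' = X" "Cod C f = A" "Cod C f' = A" "Cod C g = B" "Cod C g' = B"
  shows "\<langle>f, g\<rangle> \<oplus> \<langle>f', g'\<rangle> = \<langle>f \<oplus> f', g \<oplus> g'\<rangle>"
proof (rule pair_eqI)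
  show "A \<in> Obj C" "B \<in> Obj C"
    using assms Cod_Obj by auto
  then show "\<pi>\<^sub>1 A B \<odot> (\<langle>f, g\<rangle> \<oplus> \<langle>f', g'\<rangle>) = f \<oplus> f'"
    "\<pi>\<^sub>2 A B \<odot> (\<langle>f, g\<rangle> \<oplus> \<langle>f', g'\<rangle>) = g \<oplus> g'"
    using assms by simp_all
qed (use assms in simp_all)

end

section \<open>Derivatives, linear maps and the operation \<star>\<close>

context cartesian_differential_category
begin

lemma diff_arr [simp]:
  assumes "f \<in> Arr C"
  shows "D f \<in> Arr C" "Dom C (D f) = Dom C f \<otimes> Dom C f" "Cod C (D f) = Cod C f"
  using diff_hom[OF in_hom[OF assms]] by (simp_all add: hom_def)

lemmas [simp] = D1_zero D3_ident D3_proj1 D3_proj2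

lemma diff_plus [simp]:
  assumes "f \<in> Arr C" "g \<in> Arr C" "Dom C f = Dom C g" "Cod C f = Cod C g"
  shows "D (f \<oplus> g) = D f \<oplus> D g"
  using D1_add[of f "Dom C g" "Cod C g" g] assms by (simp add: hom_def)

lemma diff_pair [simp]:
  assumes "f \<in> Arr C" "g \<in> Arr C" "Dom C f = Dom C g"
  shows "D \<langle>f, g\<rangle> = \<langle>D f, D g\<rangle>"
  using D4[of f "Dom C g" "Cod C f" g "Cod C g"] assms by (simp add: hom_def)

lemma diff_comp [simp]:
  assumes "f \<in> Arr C" "g \<in> Arr C" "Cod C g = Dom C f"
  shows "D (f \<odot> g) = D f \<odot> \<langle>D g, g \<odot> \<pi>\<^sub>2 (Dom C g) (Dom C g)\<rangle>"
  using D5[of g "Dom C g" "Dom C f" f "Cod C f"] assms by (simp add: hom_def)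

lemma diff_dir_plus:
  assumes "f \<in> Arr C" "h \<in> Arr C" "k \<in> Arr C" "v \<in> Arr C"
    "Dom C h = Dom C v" "Dom C k = Dom C v"
    "Cod C h = Dom C f" "Cod C k = Dom C f" "Cod C v = Dom C f"
  shows "D f \<odot> \<langle>h \<oplus> k, v\<rangle> = (D f \<odot> \<langle>h, v\<rangle>) \<oplus> (D f \<odot> \<langle>k, v\<rangle>)"
  using D2_add[of f "Dom C f" "Cod C f" h "Dom C v" k v] assms by (simp add: hom_def)

lemma diff_dir_zero [simp]:
  assumes "f \<in> Arr C" "v \<in> Arr C" "X = Dom C v" "A = Dom C f" "Cod C v = Dom C f"
  shows "D f \<odot> \<langle>\<zero> X A, v\<rangle> = \<zero> X (Cod C f)"
  using D2_zero[of f A "Cod C f" v X] assms by (simp add: hom_def)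

text \<open>A linear map is its own derivative at every base point, so \<open>v\<close> drops
  out.\<close>

lemma linear_diff_comp:
  assumes "linear_arr C f" "h \<in> Arr C" "v \<in> Arr C" "Dom C h = Dom C v"
    "Cod C h = Dom C f" "Cod C v = Dom C f"
  shows "D f \<odot> \<langle>h, v\<rangle> = f \<odot> h"
proof -
  have "f \<in> Arr C" and "D f = f \<odot> \<pi>\<^sub>1 (Dom C f) (Dom C f)"
    using assms by (simp_all add: linear_arr_def)
  with assms Dom_Obj[of f] show ?thesis by simp
qed

text \<open>By \<open>linear_diff_comp\<close>, composing with \<open>f\<close> amounts to
  differentiating \<open>f\<close> in the given direction, and (D2) makes derivatives additive in
  the direction.\<close>

lemma linear_additive:
  assumes "linear_arr C f"
  shows "additive C f"
  unfolding additive_def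
proof (intro conjI ballI)
  show f: "f \<in> Arr C"
    using assms by (simp add: linear_arr_def)
  fix X assume X: "X \<in> Obj C"
  show "f \<odot> \<zero> X (Dom C f) = \<zero> X (Cod C f)"
    using linear_diff_comp[OF assms, of "\<zero> X (Dom C f)" "\<zero> X (Dom C f)"] f X Dom_Obj
    \<comment> \<open>\<open>pair_zero\<close> would merge direction and base point into a single
      zero arrow, and \<open>diff_dir_zero\<close> could no longer match.\<close>
    by (simp del: pair_zero)
  fix g h assume "g \<in> hom C X (Dom C f)" "h \<in> hom C X (Dom C f)"
  then show "f \<odot> (g \<oplus> h) = f \<odot> g \<oplus> f \<odot> h"
    using linear_diff_comp[OF assms, of "g \<oplus> h" g] linear_diff_comp[OF assms, of g g]
      linear_diff_comp[OF assms, of h g] f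
    by (simp add: hom_def diff_dir_plus)
qed

lemma star_eq:
  assumes "g \<in> Arr C" "Dom C g = X" "Cod C g = A"
  shows "f \<star> g = D f \<odot> \<langle>\<langle>\<zero> (X \<otimes> A) X, g \<odot> \<pi>\<^sub>1 X A\<rangle>, \<one> (X \<otimes> A)\<rangle>"
  using assms by (simp add: star_def)

lemma star_zero_left:
  assumes "X \<in> Obj C" "A \<in> Obj C" "B \<in> Obj C" "g \<in> Arr C" "Dom C g = X" "Cod C g = A"
  shows "\<zero> (X \<otimes> A) B \<star> g = \<zero> (X \<otimes> A) B"
  using assms by (simp add: star_eq[of _ X A])

lemma star_zero_right:
  assumes "X \<in> Obj C" "A \<in> Obj C" "f \<in> Arr C" "Dom C f = X \<otimes> A"
  shows "f \<star> \<zero> X A = \<zero> (X \<otimes> A) (Cod C f)"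
  using assms by (simp add: star_eq[of _ X A])

context
  fixes X A B f g
  assumes Obj [simp]: "X \<in> Obj C" "A \<in> Obj C"
    and f [simp]: "f \<in> Arr C" "Dom C f = X \<otimes> A" "Cod C f = B"
    and g [simp]: "g \<in> Arr C" "Dom C g = X" "Cod C g = A"
begin

lemma star_arr: "f \<star> g \<in> Arr C" "Dom C (f \<star> g) = X \<otimes> A" "Cod C (f \<star> g) = B"
  by (simp_all add: star_eq[OF g])

lemma star_add_left:
  assumes "f' \<in> Arr C" "Dom C f' = X \<otimes> A" "Cod C f' = B"
  shows "(f \<oplus> f') \<star> g = (f \<star> g) \<oplus> (f' \<star> g)"
  using assms by (simp add: star_eq[OF g])

lemma star_add_right:
  assumes h [simp]: "h \<in> Arr C" "Dom C h = X" "Cod C h = A"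
  shows "f \<star> (g \<oplus> h) = (f \<star> g) \<oplus> (f \<star> h)"
proof -
  let ?z = "\<zero> (X \<otimes> A) X"
  have "\<langle>?z, (g \<oplus> h) \<odot> \<pi>\<^sub>1 X A\<rangle> = \<langle>?z, g \<odot> \<pi>\<^sub>1 X A\<rangle> \<oplus> \<langle>?z, h \<odot> \<pi>\<^sub>1 X A\<rangle>"
    by (simp add: pair_plus[of _ _ _ _ "X \<otimes> A" X A])
  moreover have "D f \<odot> \<langle>\<langle>?z, g \<odot> \<pi>\<^sub>1 X A\<rangle> \<oplus> \<langle>?z, h \<odot> \<pi>\<^sub>1 X A\<rangle>, \<one> (X \<otimes> A)\<rangle> =
      (D f \<odot> \<langle>\<langle>?z, g \<odot> \<pi>\<^sub>1 X A\<rangle>, \<one> (X \<otimes> A)\<rangle>) \<oplus> (D f \<odot> \<langle>\<langle>?z, h \<odot> \<pi>\<^sub>1 X A\<rangle>, \<one> (X \<otimes> A)\<rangle>)"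
    by (rule diff_dir_plus) simp_all
  ultimately show ?thesis
    by (simp only: star_eq[of _ X A] add_arr g h)
qed

text \<open>Naturality of \<star> in the context. The direction vanishes in the context component,
  so \<open>r\<close> contributes no derivative of its own and only moves the base point.\<close>

lemma star_comp:
  assumes [simp]: "r \<in> Arr C" "Dom C r = Y" "Cod C r = X" "Y \<in> Obj C"
  shows "(f \<star> g) \<odot> \<langle>r \<odot> \<pi>\<^sub>1 Y A, \<pi>\<^sub>2 Y A\<rangle> = (f \<odot> \<langle>r \<odot> \<pi>\<^sub>1 Y A, \<pi>\<^sub>2 Y A\<rangle>) \<star> (g \<odot> r)"
  by (simp add: star_eq[of _ X A] star_eq[of _ Y A])

text \<open>Precomposition with \<open>\<langle>\<one> X, k\<rangle>\<close> restricts to the graph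
  of \<open>k\<close>, which is how an argument enters a function.\<close>

lemma star_comp_section:
  "(f \<star> g) \<odot> \<langle>\<one> X, k\<rangle> = D f \<odot> \<langle>\<langle>\<zero> X X, g\<rangle>, \<langle>\<one> X, k\<rangle>\<rangle>"
  if "k \<in> Arr C" "Dom C k = X" "Cod C k = A"
  using that by (simp add: star_eq[of _ X A])

text \<open>The direction \<open>g \<odot> \<pi>\<^sub>1 X A\<close> depends on the context only,
  which \<open>h\<close> leaves fixed; its derivative is therefore zero and a pure second derivative
  of \<open>f\<close> remains.\<close>

lemma star_star:
  assumes [simp]: "h \<in> Arr C" "Dom C h = X" "Cod C h = A"
  shows "(f \<star> g) \<star> h = D (D f) \<odot>
    \<langle>\<langle>\<zero> (X \<otimes> A) (X \<otimes> A), \<langle>\<zero> (X \<otimes> A) X, h \<odot> \<pi>\<^sub>1 X A\<rangle>\<rangle>,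
     \<langle>\<langle>\<zero> (X \<otimes> A) X, g \<odot> \<pi>\<^sub>1 X A\<rangle>, \<one> (X \<otimes> A)\<rangle>\<rangle>"
  by (simp add: star_eq[of _ X A])

end

text \<open>In the form of \<open>star_star\<close> the two sides differ by an exchange of the two
  directions, which is (D7).\<close>

lemma star_commute:
  assumes "X \<in> Obj C" "A \<in> Obj C" "f \<in> Arr C" "Dom C f = X \<otimes> A"
    and "g \<in> Arr C" "Dom C g = X" "Cod C g = A"
    and "h \<in> Arr C" "Dom C h = X" "Cod C h = A"
  shows "(f \<star> g) \<star> h = (f \<star> h) \<star> g"
proof -
  have "D (D f) \<odot>
    \<langle>\<langle>\<zero> (X \<otimes> A) (X \<otimes> A), \<langle>\<zero> (X \<otimes> A) X, h \<odot> \<pi>\<^sub>1 X A\<rangle>\<rangle>,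
     \<langle>\<langle>\<zero> (X \<otimes> A) X, g \<odot> \<pi>\<^sub>1 X A\<rangle>, \<one> (X \<otimes> A)\<rangle>\<rangle> = D (D f) \<odot>
    \<langle>\<langle>\<zero> (X \<otimes> A) (X \<otimes> A), \<langle>\<zero> (X \<otimes> A) X, g \<odot> \<pi>\<^sub>1 X A\<rangle>\<rangle>,
     \<langle>\<langle>\<zero> (X \<otimes> A) X, h \<odot> \<pi>\<^sub>1 X A\<rangle>, \<one> (X \<otimes> A)\<rangle>\<rangle>"
    by (rule D7) (use assms in \<open>simp_all add: hom_iff\<close>)
  with assms show ?thesis by (simp add: star_star[of X A f "Cod C f"])
qed

text \<open>The derivative of \<open>f \<star> g\<close> along a direction \<open>d\<close> acting on the context only is given by
  Leibniz' rule; (D6) produces the summand differentiating \<open>g\<close>, (D7) the one differentiating \<open>f\<close>.\<close>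

lemma diff_star:
  assumes [simp]: "X \<in> Obj C" "A \<in> Obj C" "f \<in> Arr C" "Dom C f = X \<otimes> A"
    and [simp]: "g \<in> Arr C" "Dom C g = X" "Cod C g = A"
    and [simp]: "d \<in> Arr C" "Dom C d = X" "Cod C d = X"
  defines "v \<equiv> \<langle>\<langle>d \<odot> \<pi>\<^sub>1 X A, \<zero> (X \<otimes> A) A\<rangle>, \<one> (X \<otimes> A)\<rangle>"
  shows "D (f \<star> g) \<odot> v = ((D f \<odot> v) \<star> g) \<oplus> (f \<star> (D g \<odot> \<langle>d, \<one> X\<rangle>))"
proof -
  let ?P = "X \<otimes> A"
  let ?d = "\<langle>d \<odot> \<pi>\<^sub>1 X A, \<zero> ?P A\<rangle>"
  let ?g = "\<langle>\<zero> ?P X, g \<odot> \<pi>\<^sub>1 X A\<rangle>"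
  let ?g' = "\<langle>\<zero> ?P X, D g \<odot> \<langle>d \<odot> \<pi>\<^sub>1 X A, \<pi>\<^sub>1 X A\<rangle>\<rangle>"
  \<comment> \<open>Chain rule: moving along \<open>d\<close> changes the direction
    \<open>?g\<close> by \<open>?g'\<close> and the base point by \<open>?d\<close>.\<close>
  have "D (f \<star> g) \<odot> v = D (D f) \<odot> \<langle>\<langle>?g', ?d\<rangle>, \<langle>?g, \<one> ?P\<rangle>\<rangle>"
    by (simp add: star_eq[of _ X A] v_def)
  also have "\<langle>?g', ?d\<rangle> = \<langle>\<zero> ?P ?P, ?d\<rangle> \<oplus> \<langle>?g', \<zero> ?P ?P\<rangle>"
    by (subst pair_plus[of _ _ _ _ ?P ?P ?P]) simp_all
  also have "D (D f) \<odot> \<langle>\<langle>\<zero> ?P ?P, ?d\<rangle> \<oplus> \<langle>?g', \<zero> ?P ?P\<rangle>, \<langle>?g, \<one> ?P\<rangle>\<rangle> =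
      (D (D f) \<odot> \<langle>\<langle>\<zero> ?P ?P, ?d\<rangle>, \<langle>?g, \<one> ?P\<rangle>\<rangle>) \<oplus>
      (D (D f) \<odot> \<langle>\<langle>?g', \<zero> ?P ?P\<rangle>, \<langle>?g, \<one> ?P\<rangle>\<rangle>)"
    by (rule diff_dir_plus) simp_all
  also have "D (D f) \<odot> \<langle>\<langle>?g', \<zero> ?P ?P\<rangle>, \<langle>?g, \<one> ?P\<rangle>\<rangle> = D f \<odot> \<langle>?g', \<one> ?P\<rangle>"
    by (rule D6) (simp_all add: hom_iff)
  also have "\<dots> = f \<star> (D g \<odot> \<langle>d, \<one> X\<rangle>)"
    by (simp add: star_eq[of _ X A])
  also have "D (D f) \<odot> \<langle>\<langle>\<zero> ?P ?P, ?d\<rangle>, \<langle>?g, \<one> ?P\<rangle>\<rangle> = D (D f) \<odot> \<langle>\<langle>\<zero> ?P ?P, ?g\<rangle>, \<langle>?d, \<one> ?P\<rangle>\<rangle>"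
    by (rule D7) (simp_all add: hom_iff)
  \<comment> \<open>Moving along \<open>?g\<close> fixes the context, so the direction inside
    \<open>v\<close> has derivative zero and only the base point of \<open>v\<close> varies.\<close>
  also have "\<dots> = (D f \<odot> v) \<star> g"
    by (simp add: star_eq[of _ X A] v_def)
  finally show ?thesis .
qed

end

section \<open>Currying, evaluation and their derivatives\<close>

context cartesian_closed_differential_category
begin

lemmas [simp] = exp_Obj

lemma eval_arr [simp]:
  assumes "A \<in> Obj C" "B \<in> Obj C"
  shows "eval_arr C A B \<in> Arr C" "Dom C (eval_arr C A B) = exp_obj C A B \<otimes> A"
    "Cod C (eval_arr C A B) = B"
  using eval_hom[OF assms] by (simp_all add: hom_def)

lemma curry_arr [simp]:
  assumes "X \<in> Obj C" "A \<in> Obj C" "f \<in> Arr C" "Dom C f = X \<otimes> A"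
  shows "\<Lambda> X A f \<in> Arr C" "Dom C (\<Lambda> X A f) = X" "Cod C (\<Lambda> X A f) = exp_obj C A (Cod C f)"
  using curry_hom[of X A f "Cod C f"] assms by (simp_all add: hom_def)

lemma eval_curry_proj:
  assumes "X \<in> Obj C" "A \<in> Obj C" "f \<in> Arr C" "Dom C f = X \<otimes> A" "Cod C f = B"
  shows "eval_arr C A B \<odot> \<langle>\<Lambda> X A f \<odot> \<pi>\<^sub>1 X A, \<pi>\<^sub>2 X A\<rangle> = f"
  using eval_curry[of X A f B] assms by (simp add: hom_def prod_arr_def)

lemma eval_curry_comp:
  assumes "X \<in> Obj C" "A \<in> Obj C" "f \<in> Arr C" "Dom C f = X \<otimes> A" "Cod C f = B"
    and "h \<in> Arr C" "k \<in> Arr C" "Dom C h = Dom C k" "Cod C h = X" "Cod C k = A"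
  shows "eval_arr C A B \<odot> \<langle>\<Lambda> X A f \<odot> h, k\<rangle> = f \<odot> \<langle>h, k\<rangle>"
proof -
  have B: "B \<in> Obj C"
    using assms Cod_Obj by auto
  have "f \<odot> \<langle>h, k\<rangle> = (eval_arr C A B \<odot> \<langle>\<Lambda> X A f \<odot> \<pi>\<^sub>1 X A, \<pi>\<^sub>2 X A\<rangle>) \<odot> \<langle>h, k\<rangle>"
    using assms by (simp only: eval_curry_proj)
  then show ?thesis
    using assms B by simp
qed

text \<open>For the identity in place of \<open>h\<close>, simplification erases the composite that
  \<open>eval_curry_comp\<close> looks for; this covers the erased form.\<close>

lemma eval_curry_pair:
  assumes "X \<in> Obj C" "A \<in> Obj C" "f \<in> Arr C" "Dom C f = X \<otimes> A" "Cod C f = B"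
    and "k \<in> Arr C" "Dom C k = X" "Cod C k = A"
  shows "eval_arr C A B \<odot> \<langle>\<Lambda> X A f, k\<rangle> = f \<odot> \<langle>\<one> X, k\<rangle>"
  using eval_curry_comp[OF assms(1-5), of "\<one> X" k] assms by simp

lemma curry_eqI:
  assumes "A \<in> Obj C" "B \<in> Obj C" "h \<in> Arr C" "Dom C h = X" "Cod C h = exp_obj C A B"
    and "eval_arr C A B \<odot> \<langle>h \<odot> \<pi>\<^sub>1 X A, \<pi>\<^sub>2 X A\<rangle> = f"
  shows "h = \<Lambda> X A f"
proof (rule curry_unique)
  show "X \<in> Obj C"
    using assms Dom_Obj by auto
  then show "eval_arr C A B \<odot> (h \<boxtimes> \<one> A) = f" "f \<in> hom C (X \<otimes> A) B"
    using assms by (simp_all add: prod_arr_def hom_iff flip: assms(6))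
qed (use assms in \<open>simp_all add: hom_iff\<close>)

text \<open>Currying is natural in the context, by uniqueness of the transpose.\<close>

lemma curry_comp:
  assumes "X \<in> Obj C" "A \<in> Obj C" "f \<in> Arr C" "Dom C f = X \<otimes> A"
    and "r \<in> Arr C" "Dom C r = Y" "Cod C r = X"
  shows "\<Lambda> X A f \<odot> r = \<Lambda> Y A (f \<odot> \<langle>r \<odot> \<pi>\<^sub>1 Y A, \<pi>\<^sub>2 Y A\<rangle>)"
proof (rule curry_eqI)
  have "Y \<in> Obj C" "Cod C f \<in> Obj C"
    using assms Dom_Obj Cod_Obj by auto
  with assms show "eval_arr C A (Cod C f) \<odot> \<langle>(\<Lambda> X A f \<odot> r) \<odot> \<pi>\<^sub>1 Y A, \<pi>\<^sub>2 Y A\<rangle> =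
      f \<odot> \<langle>r \<odot> \<pi>\<^sub>1 Y A, \<pi>\<^sub>2 Y A\<rangle>"
    by (simp add: eval_curry_comp)
qed (use assms Cod_Obj in simp_all)

lemma curry_plus:
  assumes "X \<in> Obj C" "A \<in> Obj C" "f \<in> Arr C" "Dom C f = X \<otimes> A"
    and "g \<in> Arr C" "Dom C g = X \<otimes> A" "Cod C f = Cod C g"
  shows "\<Lambda> X A (f \<oplus> g) = \<Lambda> X A f \<oplus> \<Lambda> X A g"
  using curry_add[of X A f "Cod C g" g] assms by (simp add: hom_iff)

text \<open>The axiom for \<open>D\<close> of a curried map, pulled back along
  \<open>\<langle>d, \<one> X\<rangle>\<close>: a derivative passes under the abstraction with
  direction zero in the abstracted argument.\<close>

lemma diff_curry_comp:
  assumes "X \<in> Obj C" "A \<in> Obj C" "f \<in> Arr C" "Dom C f = X \<otimes> A"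
    and "d \<in> Arr C" "Dom C d = X" "Cod C d = X"
  shows "D (\<Lambda> X A f) \<odot> \<langle>d, \<one> X\<rangle> =
    \<Lambda> X A (D f \<odot> \<langle>\<langle>d \<odot> \<pi>\<^sub>1 X A, \<zero> (X \<otimes> A) A\<rangle>, \<one> (X \<otimes> A)\<rangle>)"
proof -
  have "D (\<Lambda> X A f) = \<Lambda> (X \<otimes> X) A (D f \<odot> \<langle>\<pi>\<^sub>1 X X \<boxtimes> \<zero> A A, \<pi>\<^sub>2 X X \<boxtimes> \<one> A\<rangle>)"
    using assms by (intro diff_curry[of X A f "Cod C f"]) (simp_all add: hom_iff)
  with assms show ?thesis
    by (simp add: curry_comp prod_arr_def)
qed

lemma uncurry_eq:
  assumes "h \<in> Arr C" "Dom C h = X" "A \<in> Obj C"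
  shows "uncurry_arr C A B h = eval_arr C A B \<odot> \<langle>h \<odot> \<pi>\<^sub>1 X A, \<pi>\<^sub>2 X A\<rangle>"
proof -
  have "X \<in> Obj C"
    using assms Dom_Obj by auto
  with assms show ?thesis
    by (simp add: uncurry_arr_def prod_arr_def)
qed

lemma uncurry_curry:
  assumes "X \<in> Obj C" "A \<in> Obj C" "f \<in> Arr C" "Dom C f = X \<otimes> A" "Cod C f = B"
  shows "uncurry_arr C A B (\<Lambda> X A f) = f"
  using assms by (simp add: uncurry_eq[of _ X] eval_curry_proj)

lemma uncurry_zero:
  assumes "A \<in> Obj C" "B \<in> Obj C" "X \<in> Obj C"
  shows "uncurry_arr C A B (\<zero> X (exp_obj C A B)) = \<zero> (X \<otimes> A) B"
  using assms uncurry_curry[of X A "\<zero> (X \<otimes> A) B" B] by (simp add: curry_zero)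

context
  fixes A B X h
  assumes Obj [simp]: "A \<in> Obj C" "B \<in> Obj C" "X \<in> Obj C"
    and h [simp]: "h \<in> Arr C" "Dom C h = X" "Cod C h = exp_obj C A B"
begin

lemma uncurry_arrow:
  "uncurry_arr C A B h \<in> Arr C" "Dom C (uncurry_arr C A B h) = X \<otimes> A"
  "Cod C (uncurry_arr C A B h) = B"
  by (simp_all add: uncurry_eq[of _ X])

lemma curry_uncurry: "\<Lambda> X A (uncurry_arr C A B h) = h"
  by (rule curry_eqI[symmetric]) (simp_all add: uncurry_eq[of _ X])

text \<open>Reduces application to restriction of a map on the extended context to the graph of
  \<open>k\<close>, where left additivity and the chain rule are available.\<close>

lemma uncurry_pair:
  assumes "k \<in> Arr C" "Dom C k = X" "Cod C k = A"
  shows "eval_arr C A B \<odot> \<langle>h, k\<rangle> = uncurry_arr C A B h \<odot> \<langle>\<one> X, k\<rangle>"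
  using assms by (simp add: uncurry_eq[of _ X])

lemma uncurry_comp:
  assumes "r \<in> Arr C" "Dom C r = Y" "Cod C r = X" "Y \<in> Obj C"
  shows "uncurry_arr C A B (h \<odot> r) = uncurry_arr C A B h \<odot> \<langle>r \<odot> \<pi>\<^sub>1 Y A, \<pi>\<^sub>2 Y A\<rangle>"
  using assms by (simp add: uncurry_eq[of _ X] uncurry_eq[of _ Y])

text \<open>Evaluation is additive in its function argument because currying is an additive
  bijection with inverse \<open>uncurry_arr\<close>.\<close>

lemma uncurry_plus:
  assumes k [simp]: "k \<in> Arr C" "Dom C k = X" "Cod C k = exp_obj C A B"
  shows "uncurry_arr C A B (h \<oplus> k) = uncurry_arr C A B h \<oplus> uncurry_arr C A B k"
proof -
  let ?f = "uncurry_arr C A B h" and ?g = "uncurry_arr C A B k"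
  have g: "?g \<in> Arr C" "Dom C ?g = X \<otimes> A" "Cod C ?g = B" "\<Lambda> X A ?g = k"
    by (simp_all add: uncurry_eq[of _ X])
      (rule curry_eqI[symmetric]; simp add: uncurry_eq[of _ X])
  have "h \<oplus> k = \<Lambda> X A (?f \<oplus> ?g)"
    by (simp add: curry_plus uncurry_arrow g curry_uncurry)
  then show ?thesis
    by (simp add: uncurry_curry uncurry_arrow g)
qed

text \<open>Differentiating an application \<open>ev \<circ> \<langle>h, k\<rangle>\<close> along \<open>d\<close>: the direction splits into
  \<open>\<langle>d, 0\<rangle>\<close>, which differentiates the function, and \<open>\<langle>0, D k \<circ> \<langle>d, 1\<rangle>\<rangle>\<close>, which
  differentiates the argument.\<close>

lemma diff_eval_pair:
  assumes k [simp]: "k \<in> Arr C" "Dom C k = X" "Cod C k = A"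
    and d [simp]: "d \<in> Arr C" "Dom C d = X" "Cod C d = X"
  shows "D (eval_arr C A B \<odot> \<langle>h, k\<rangle>) \<odot> \<langle>d, \<one> X\<rangle> =
    (eval_arr C A B \<odot> \<langle>D h \<odot> \<langle>d, \<one> X\<rangle>, k\<rangle>) \<oplus>
    ((uncurry_arr C A B h \<star> (D k \<odot> \<langle>d, \<one> X\<rangle>)) \<odot> \<langle>\<one> X, k\<rangle>)"
proof -
  let ?f = "uncurry_arr C A B h" and ?k = "D k \<odot> \<langle>d, \<one> X\<rangle>"
  have [simp]: "?f \<in> Arr C" "Dom C ?f = X \<otimes> A" "Cod C ?f = B"
    by (rule uncurry_arrow)+
  have "D (eval_arr C A B \<odot> \<langle>h, k\<rangle>) \<odot> \<langle>d, \<one> X\<rangle> = D ?f \<odot> \<langle>\<langle>d, ?k\<rangle>, \<langle>\<one> X, k\<rangle>\<rangle>"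
    by (simp add: uncurry_pair)
  also have "\<langle>d, ?k\<rangle> = \<langle>d, \<zero> X A\<rangle> \<oplus> \<langle>\<zero> X X, ?k\<rangle>"
    by (subst pair_plus[of _ _ _ _ X X A]) simp_all
  also have "D ?f \<odot> \<langle>\<dots>, \<langle>\<one> X, k\<rangle>\<rangle> =
      (D ?f \<odot> \<langle>\<langle>d, \<zero> X A\<rangle>, \<langle>\<one> X, k\<rangle>\<rangle>) \<oplus> (D ?f \<odot> \<langle>\<langle>\<zero> X X, ?k\<rangle>, \<langle>\<one> X, k\<rangle>\<rangle>)"
    by (rule diff_dir_plus) simp_all
  also have "D ?f \<odot> \<langle>\<langle>\<zero> X X, ?k\<rangle>, \<langle>\<one> X, k\<rangle>\<rangle> = (?f \<star> ?k) \<odot> \<langle>\<one> X, k\<rangle>"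
    by (rule star_comp_section[symmetric]) simp_all
  \<comment> \<open>With the argument held fixed, differentiation commutes with currying, so this
    summand is again an application. The curried \<open>?f\<close> turns back into \<open>h\<close>
    at the end.\<close>
  also have "D ?f \<odot> \<langle>\<langle>d, \<zero> X A\<rangle>, \<langle>\<one> X, k\<rangle>\<rangle> =
      eval_arr C A B \<odot> \<langle>D (\<Lambda> X A ?f) \<odot> \<langle>d, \<one> X\<rangle>, k\<rangle>"
    by (simp add: diff_curry_comp eval_curry_pair)
  finally show ?thesis
    by (simp only: curry_uncurry)
qed

end

end

section \<open>The operations of a linear reflexive object\<close>

locale linear_reflexive = cartesian_closed_differential_category C
  for C :: "('o, 'm, 'x) ccd_cat_scheme" (structure) +
  fixes U :: 'o and \<A> \<l> :: 'm
  assumes reflexive: "linear_reflexive_object C U \<A> \<l>"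
begin

lemma U_Obj [simp]: "U \<in> Obj C"
  and fun_arr [simp]: "\<A> \<in> Arr C" "Dom C \<A> = U" "Cod C \<A> = exp_obj C U U"
  and abs_arr [simp]: "\<l> \<in> Arr C" "Dom C \<l> = exp_obj C U U" "Cod C \<l> = U"
  and fun_abs: "\<A> \<odot> \<l> = \<one> (exp_obj C U U)"
  and fun_linear: "linear_arr C \<A>"
  and abs_linear: "linear_arr C \<l>"
  using reflexive by (simp_all add: linear_reflexive_object_def hom_iff)

lemma additive [simp]: "additive C \<A>" "additive C \<l>"
  by (simp_all add: linear_additive fun_linear abs_linear)

lemma fun_abs_comp:
  assumes "f \<in> Arr C" "Cod C f = exp_obj C U U"
  shows "\<A> \<odot> (\<l> \<odot> f) = f"
proof -
  have "\<A> \<odot> (\<l> \<odot> f) = (\<A> \<odot> \<l>) \<odot> f"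
    using assms by (subst assoc) simp_all
  then show ?thesis
    using assms by (simp add: fun_abs)
qed

text \<open>The generalised elements of \<open>U\<close> at stage \<open>X\<close>: the kind of
  arrow that interprets a term in a context.\<close>

abbreviation el :: "'o \<Rightarrow> 'm \<Rightarrow> bool" where
  "el X f \<equiv> f \<in> Arr C \<and> Dom C f = X \<and> Cod C f = U"

definition lam_op :: "'o \<Rightarrow> 'm \<Rightarrow> 'm" where
  "lam_op X f = \<l> \<odot> \<Lambda> X U f"

definition app_op :: "'m \<Rightarrow> 'm \<Rightarrow> 'm" where
  "app_op h k = eval_arr C U U \<odot> \<langle>\<A> \<odot> h, k\<rangle>"

definition dif_op :: "'o \<Rightarrow> 'm \<Rightarrow> 'm \<Rightarrow> 'm" where
  "dif_op X h k = \<l> \<odot> \<Lambda> X U (uncurry_arr C U U (\<A> \<odot> h) \<star> k)"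

text \<open>Through this form the facts about \<open>lam_op\<close> carry over to differential
  application.\<close>

lemma dif_op_eq_lam: "dif_op X h k = lam_op X (uncurry_arr C U U (\<A> \<odot> h) \<star> k)"
  by (simp add: dif_op_def lam_op_def)

context
  fixes X
  assumes X [simp]: "X \<in> Obj C"
begin

lemma lam_op_el: "el (X \<otimes> U) f \<Longrightarrow> el X (lam_op X f)"
  by (simp add: lam_op_def)

lemma app_op_el: "el X h \<Longrightarrow> el X k \<Longrightarrow> el X (app_op h k)"
  by (simp add: app_op_def)

lemma uncurry_fun_el: "el X h \<Longrightarrow> el (X \<otimes> U) (uncurry_arr C U U (\<A> \<odot> h))"
  by (simp add: uncurry_arrow[of U U X])

lemma star_el: "el (X \<otimes> U) f \<Longrightarrow> el X k \<Longrightarrow> el (X \<otimes> U) (f \<star> k)"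
  by (simp add: star_arr[of X U])

lemma dif_op_el: "el X h \<Longrightarrow> el X k \<Longrightarrow> el X (dif_op X h k)"
  using star_el[OF uncurry_fun_el] by (simp add: dif_op_def)

lemma lam_op_add: "el (X \<otimes> U) f \<Longrightarrow> el (X \<otimes> U) g \<Longrightarrow> lam_op X (f \<oplus> g) = lam_op X f \<oplus> lam_op X g"
  by (simp add: lam_op_def curry_plus)

lemma lam_op_zero: "lam_op X (\<zero> (X \<otimes> U) U) = \<zero> X U"
  by (simp add: lam_op_def curry_zero)

text \<open>Only the function position is additive, in agreement with \<open>apps\<close>, which
  distributes over its first argument alone.\<close>

lemma app_op_add:
  assumes "el X h" "el X h'" "el X k"
  shows "app_op (h \<oplus> h') k = app_op h k \<oplus> app_op h' k"
  using assms uncurry_fun_el[of h] uncurry_fun_el[of h']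
  by (simp add: app_op_def uncurry_pair[of U U X] uncurry_plus[of U U X])

lemma app_op_zero: "el X k \<Longrightarrow> app_op (\<zero> X U) k = \<zero> X U"
  by (simp add: app_op_def uncurry_pair[of U U X] uncurry_zero)

lemma dif_op_add_left:
  assumes "el X h" "el X h'" "el X k"
  shows "dif_op X (h \<oplus> h') k = dif_op X h k \<oplus> dif_op X h' k"
  using assms uncurry_fun_el[of h] uncurry_fun_el[of h'] star_el
  by (simp add: dif_op_def uncurry_plus[of U U X] star_add_left[of X U _ U] curry_plus)

lemma dif_op_zero_left: "el X k \<Longrightarrow> dif_op X (\<zero> X U) k = \<zero> X U"
  by (simp add: dif_op_def uncurry_zero star_zero_left curry_zero)

lemma dif_op_add_right:
  assumes "el X h" "el X k" "el X k'"
  shows "dif_op X h (k \<oplus> k') = dif_op X h k \<oplus> dif_op X h k'"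
  using assms uncurry_fun_el[of h] star_el
  by (simp add: dif_op_def star_add_right[of X U _ U] curry_plus)

lemma dif_op_zero_right: "el X h \<Longrightarrow> dif_op X h (\<zero> X U) = \<zero> X U"
  using uncurry_fun_el[of h] by (simp add: dif_op_def star_zero_right curry_zero)

text \<open>Both beta rules rest on this cancellation: \<open>\<A> \<odot> \<l>\<close> is the
  identity, and uncurrying undoes currying.\<close>

lemma uncurry_fun_lam: "el (X \<otimes> U) f \<Longrightarrow> uncurry_arr C U U (\<A> \<odot> lam_op X f) = f"
  by (simp add: lam_op_def fun_abs_comp uncurry_curry)

lemma app_op_lam: "el (X \<otimes> U) f \<Longrightarrow> el X k \<Longrightarrow> app_op (lam_op X f) k = f \<odot> \<langle>\<one> X, k\<rangle>"
  by (simp add: app_op_def lam_op_def fun_abs_comp eval_curry_pair)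

lemma dif_op_lam: "el (X \<otimes> U) f \<Longrightarrow> dif_op X (lam_op X f) k = lam_op X (f \<star> k)"
  by (simp add: dif_op_def uncurry_fun_lam) (simp add: lam_op_def)

text \<open>The inner \<open>\<l>\<close> cancels against the outer \<open>\<A>\<close>, which
  leaves an iterated \<star> under one abstraction; \<open>star_commute\<close> exchanges its two
  arguments.\<close>

lemma dif_op_commute:
  assumes "el X h" "el X j" "el X k"
  shows "dif_op X (dif_op X h j) k = dif_op X (dif_op X h k) j"
  using assms uncurry_fun_el[of h] star_el
  by (simp add: dif_op_eq_lam uncurry_fun_lam star_commute[of X U])

context
  fixes Y r
  assumes Y [simp]: "Y \<in> Obj C" and r [simp]: "r \<in> Arr C" "Dom C r = Y" "Cod C r = X"
begin

lemma lam_op_comp: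
  "el (X \<otimes> U) f \<Longrightarrow> lam_op X f \<odot> r = lam_op Y (f \<odot> \<langle>r \<odot> \<pi>\<^sub>1 Y U, \<pi>\<^sub>2 Y U\<rangle>)"
  by (simp add: lam_op_def curry_comp)

lemma app_op_comp: "el X h \<Longrightarrow> el X k \<Longrightarrow> app_op h k \<odot> r = app_op (h \<odot> r) (k \<odot> r)"
  by (simp add: app_op_def)

lemma dif_op_comp:
  assumes "el X h" "el X k"
  shows "dif_op X h k \<odot> r = dif_op Y (h \<odot> r) (k \<odot> r)"
proof -
  have "uncurry_arr C U U (\<A> \<odot> (h \<odot> r)) =
      uncurry_arr C U U (\<A> \<odot> h) \<odot> \<langle>r \<odot> \<pi>\<^sub>1 Y U, \<pi>\<^sub>2 Y U\<rangle>"
    using assms uncurry_comp[of U U X "\<A> \<odot> h" r Y] by simp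
  with assms uncurry_fun_el[of h] star_el show ?thesis
    by (simp add: dif_op_eq_lam lam_op_comp star_comp[of X U _ U])
qed

end

context
  fixes d
  assumes d [simp]: "d \<in> Arr C" "Dom C d = X" "Cod C d = X"
begin

text \<open>Linearity lets \<open>\<l>\<close> pass out of the derivative, and
  \<open>diff_curry_comp\<close> does the rest. The bound variable receives direction zero.\<close>

lemma diff_lam_op:
  assumes "el (X \<otimes> U) f"
  shows "D (lam_op X f) \<odot> \<langle>d, \<one> X\<rangle> =
    lam_op X (D f \<odot> \<langle>\<langle>d \<odot> \<pi>\<^sub>1 X U, \<zero> (X \<otimes> U) U\<rangle>, \<one> (X \<otimes> U)\<rangle>)"
  using assms
  by (simp add: lam_op_def linear_diff_comp[OF abs_linear] diff_curry_comp)

lemma diff_app_op: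
  assumes "el X h" "el X k"
  shows "D (app_op h k) \<odot> \<langle>d, \<one> X\<rangle> =
    app_op (D h \<odot> \<langle>d, \<one> X\<rangle>) k \<oplus> app_op (dif_op X h (D k \<odot> \<langle>d, \<one> X\<rangle>)) k"
proof -
  have "D (\<A> \<odot> h) \<odot> \<langle>d, \<one> X\<rangle> = \<A> \<odot> (D h \<odot> \<langle>d, \<one> X\<rangle>)"
    using assms by (simp add: linear_diff_comp[OF fun_linear])
  \<comment> \<open>The second summand of \<open>diff_eval_pair\<close> is a beta-reduct:
    abstracting it and applying the result to \<open>k\<close> yields the second summand of the
    syntactic Leibniz rule.\<close>
  moreover have "app_op (dif_op X h (D k \<odot> \<langle>d, \<one> X\<rangle>)) k =
      (uncurry_arr C U U (\<A> \<odot> h) \<star> (D k \<odot> \<langle>d, \<one> X\<rangle>)) \<odot> \<langle>\<one> X, k\<rangle>"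
    using assms uncurry_fun_el[of h] star_el by (simp add: dif_op_eq_lam app_op_lam)
  moreover note diff_eval_pair[of U U X "\<A> \<odot> h" k d]
  ultimately show ?thesis
    \<comment> \<open>The chain rule is switched off so that the derivative of the application stays
      in the form of \<open>diff_eval_pair\<close>.\<close>
    using assms by (simp add: app_op_def del: diff_comp)
qed

lemma diff_dif_op:
  assumes "el X h" "el X k"
  shows "D (dif_op X h k) \<odot> \<langle>d, \<one> X\<rangle> =
    dif_op X (D h \<odot> \<langle>d, \<one> X\<rangle>) k \<oplus> dif_op X h (D k \<odot> \<langle>d, \<one> X\<rangle>)"
proof -
  let ?f = "uncurry_arr C U U (\<A> \<odot> h)"
  let ?v = "\<langle>\<langle>d \<odot> \<pi>\<^sub>1 X U, \<zero> (X \<otimes> U) U\<rangle>, \<one> (X \<otimes> U)\<rangle>"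
  have f: "el (X \<otimes> U) ?f"
    using assms(1) by (rule uncurry_fun_el)
  \<comment> \<open>The derivative is carried through \<open>\<Lambda>\<close> and the linear
    \<open>\<A>\<close> down to \<open>h\<close>; this identifies the first summand given by
    \<open>diff_star\<close>.\<close>
  have "\<Lambda> X U (D ?f \<odot> ?v) = D (\<Lambda> X U ?f) \<odot> \<langle>d, \<one> X\<rangle>"
    using f by (simp add: diff_curry_comp)
  also have "\<dots> = D (\<A> \<odot> h) \<odot> \<langle>d, \<one> X\<rangle>"
    using assms by (simp add: curry_uncurry)
  also have "\<dots> = \<A> \<odot> (D h \<odot> \<langle>d, \<one> X\<rangle>)"
    using assms by (simp add: linear_diff_comp[OF fun_linear])
  finally have "uncurry_arr C U U (\<A> \<odot> (D h \<odot> \<langle>d, \<one> X\<rangle>)) = D ?f \<odot> ?v"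
    using f uncurry_curry[of X U "D ?f \<odot> ?v" U] by simp
  then show ?thesis
    using assms f star_el diff_star[of X U ?f k d]
    by (simp add: dif_op_eq_lam diff_lam_op lam_op_add)
qed

end

end

end

section \<open>Free variables\<close>

lemma FVs_simps [simp]:
  "FVs [] = {}" "FVs (s # S) = FV s \<union> FVs S" "FVs (S @ T) = FVs S \<union> FVs T"
  "FVs (concat (map F V)) = (\<Union>v \<in> set V. FVs (F v))"
  by (auto simp: FVs_def)

lemma FVs_map_rename: "FVs (map (rename r) S) = r ` FVs S"
  by (auto simp: FVs_def FV_rename)

lemma FVs_map_Lam: "FVs (map Lam S) = {y. Suc y \<in> FVs S}"
  by (auto simp: FVs_def)

lemma FVs_lams: "FVs (lams x S) = FVs S - {x}"
  by (auto simp: FVs_def lams_def FV_lam)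

lemma FVs_apps: "FVs (apps S T) \<subseteq> FVs S \<union> FVs T"
  by (auto simp: FVs_def apps_def)

lemma FVs_difs: "FVs (difs S T) \<subseteq> FVs S \<union> FVs T"
  by (auto simp: FVs_def difs_def)

lemma FV_App: "FV (App s T) = FV s \<union> FVs T"
  by (simp add: FVs_def)

lemma FVs_subst: "FVs (subst s x T) \<subseteq> (FV s - {x}) \<union> FVs T"
proof (induction s arbitrary: x T)
  case (Lam s)
  show ?case
    using Lam[of "Suc x" "map (rename Suc) T"] by (auto simp: FVs_map_Lam FVs_map_rename)
next
  case (App s V)
  let ?V = "concat (map (\<lambda>v. subst v x T) V)"
  have "FVs ?V \<subseteq> (FVs V - {x}) \<union> FVs T"
  proof
    fix y assume "y \<in> FVs ?V"
    then obtain v where "v \<in> set V" "y \<in> FVs (subst v x T)" by auto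
    then show "y \<in> (FVs V - {x}) \<union> FVs T"
      using App.IH(2)[of v x T] by (auto simp: FVs_def[of V])
  qed
  then show ?case
    using App.IH(1)[of x T] FVs_apps[of "subst s x T" ?V]
    by (simp del: FV.simps FVs_simps(4) add: FV_App) blast
next
  case (Dif s u)
  then show ?case
    using FVs_difs[of "subst s x T" "subst u x T"] by fastforce
qed auto

text \<open>Unlike in \<open>FVs_subst\<close>, \<open>x\<close> is not removed: differential
  substitution replaces a single linear occurrence and may leave others free.\<close>

lemma FVs_dsubst: "FVs (dsubst s x T) \<subseteq> FV s \<union> FVs T"
proof (induction s arbitrary: x T)
  case (Lam s)
  show ?case
    using Lam[of "Suc x" "map (rename Suc) T"] by (auto simp: FVs_map_Lam FVs_map_rename)
next
  case (App s V)
  let ?V = "concat (map (\<lambda>v. dsubst v x T) V)"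
  have "FVs ?V \<subseteq> FVs V \<union> FVs T"
  proof
    fix y assume "y \<in> FVs ?V"
    then obtain v where "v \<in> set V" "y \<in> FVs (dsubst v x T)" by auto
    then show "y \<in> FVs V \<union> FVs T"
      using App.IH(2)[of v x T] by (auto simp: FVs_def[of V])
  qed
  then show ?case
    using App.IH(1)[of x T] FVs_apps[of "dsubst s x T" V] FVs_apps[of "difs [s] ?V" V]
      FVs_difs[of "[s]" ?V]
    by (simp del: FV.simps FVs_simps(4) add: FV_App) blast
next
  case (Dif s u)
  then show ?case
    using FVs_difs[of "dsubst s x T" "[u]"] FVs_difs[of "[s]" "dsubst u x T"] by fastforce
qed auto

lemma FVs_mset: "mset S = mset T \<Longrightarrow> FVs S = FVs T"
  using mset_eq_setD[of S T] by (simp add: FVs_def)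

lemma FV_Difn: "FV (Difn s ts) = FV s \<union> FVs ts"
  by (induction ts arbitrary: s) auto

text \<open>Guarantees that adequate contexts exist. For \<open>Lam\<close> the set is the preimage
  of a finite set under the injective \<open>Suc\<close>.\<close>

lemma finite_FV: "finite (FV s)"
proof (induction s)
  case (Lam s)
  then show ?case
    using finite_vimageI[of "FV s" Suc] by (simp add: vimage_def)
qed auto

lemma finite_FVs: "finite (FVs S)"
  by (simp add: FVs_def finite_FV)

lemma FV_Lam_subset: "FV (Lam s) \<subseteq> set xs \<Longrightarrow> FV s \<subseteq> set (0 # map Suc xs)"
proof
  fix y assume "FV (Lam s) \<subseteq> set xs" "y \<in> FV s"
  then show "y \<in> set (0 # map Suc xs)" by (cases y) auto
qed

section \<open>Interpretation of substitutions\<close>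

context linear_reflexive
begin

abbreviation "ctx \<equiv> ctx_obj C U"
abbreviation "prj \<equiv> ctx_proj C U"
abbreviation "sem \<equiv> interp C U \<A> \<l>"
abbreviation "sems \<equiv> interps C U \<A> \<l>"

lemma ctx_Obj [simp]: "ctx xs \<in> Obj C"
  by (induction xs) simp_all

lemma ctx_Suc [simp]: "ctx (map Suc xs) = ctx xs"
  by (rule ctx_obj_map)

lemma prj_Suc [simp]: "prj (map Suc xs) (Suc y) = prj xs y"
  by (rule ctx_proj_map) simp

lemma prj_el: "y \<in> set xs \<Longrightarrow> el (ctx xs) (prj xs y)"
  by (induction xs) auto

lemma prj_zero: "y \<in> set xs \<Longrightarrow> X \<in> Obj C \<Longrightarrow> prj xs y \<odot> \<zero> X (ctx xs) = \<zero> X U"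
proof (induction xs)
  case (Cons x xs)
  then show ?case using prj_el[of y xs] by auto
qed simp

text \<open>From here on terms are seen only through the operations, so that the lemmas about these
  match; the defining equations leave the simplifier below.\<close>

lemma sem_simps:
  "sem (Lam s) xs = lam_op (ctx xs) (sem s (0 # map Suc xs))"
  "sem (App s T) xs = app_op (sem s xs) (sems T xs)"
  "sem (Dif s t) xs = dif_op (ctx xs) (sem s xs) (sem t xs)"
  by (simp_all add: lam_op_def app_op_def dif_op_def interps_def)

declare interp.simps(2-4) [simp del]

lemma sems_simps:
  "sems [] xs = \<zero> (ctx xs) U" "sems (s # S) xs = sem s xs \<oplus> sems S xs"
  by (simp_all add: interps_def)

text \<open>The typing of the summands is a hypothesis here because inside the induction of
  \<open>sem_el\<close> it is known only for the arguments of the application at hand.\<close>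

lemma sems_el_if: "(\<And>s. s \<in> set S \<Longrightarrow> el (ctx xs) (sem s xs)) \<Longrightarrow> el (ctx xs) (sems S xs)"
  by (induction S) (simp_all add: sems_simps)

lemma sem_el: "FV s \<subseteq> set xs \<Longrightarrow> el (ctx xs) (sem s xs)"
proof (induction s arbitrary: xs)
  case (Var y)
  then show ?case by (simp add: prj_el)
next
  case (Lam s)
  then show ?case
    using Lam.IH[OF FV_Lam_subset[OF Lam.prems]] lam_op_el[of "ctx xs"] by (simp add: sem_simps)
next
  case (App s T)
  have "el (ctx xs) (sems T xs)"
  proof (rule sems_el_if)
    fix t assume "t \<in> set T"
    then show "el (ctx xs) (sem t xs)"
      using App.prems by (intro App.IH(2)) auto
  qed
  then show ?case
    using App app_op_el[of "ctx xs"] by (simp add: sem_simps)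
next
  case (Dif s t)
  then show ?case
    using dif_op_el[of "ctx xs"] by (simp add: sem_simps)
qed

lemma sems_el: "FVs S \<subseteq> set xs \<Longrightarrow> el (ctx xs) (sems S xs)"
  by (rule sems_el_if, rule sem_el) (auto simp: FVs_def)

lemma sems_singleton: "FV s \<subseteq> set xs \<Longrightarrow> sems [s] xs = sem s xs"
  using sem_el by (simp add: sems_simps)

lemma sems_append:
  "FVs S \<subseteq> set xs \<Longrightarrow> FVs T \<subseteq> set xs \<Longrightarrow> sems (S @ T) xs = sems S xs \<oplus> sems T xs"
proof (induction S)
  case Nil
  then show ?case using sems_el[of T xs] by (simp add: sems_simps)
next
  case (Cons s S)
  then show ?case
    using sems_el[of T xs] sems_el[of S xs] sem_el[of s xs] by (simp add: sems_simps plus_assoc)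
qed

lemma sems_mset:
  "mset S = mset T \<Longrightarrow> FVs S \<subseteq> set xs \<Longrightarrow> sems S xs = sems T xs"
proof (induction S arbitrary: T)
  case Nil
  then show ?case by simp
next
  case (Cons s S)
  then have "s \<in> set T"
    by (metis list.set_intros(1) set_mset_mset)
  then obtain T1 T2 where T: "T = T1 @ s # T2"
    by (meson split_list)
  with Cons.prems have eq: "mset S = mset (T1 @ T2)"
    by simp
  have "FVs T \<subseteq> set xs"
    using Cons.prems(2-) FVs_mset[OF Cons.prems(1)] by auto
  then have fv: "FV s \<subseteq> set xs" "FVs T1 \<subseteq> set xs" "FVs T2 \<subseteq> set xs"
    by (auto simp: T)
  have "sems S xs = sems T1 xs \<oplus> sems T2 xs"
    using Cons.IH[OF eq] Cons.prems fv by (simp add: sems_append)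
  then show ?case
    using fv sem_el[of s xs] sems_el[of T1 xs] sems_el[of T2 xs]
      plus_commute[of "sems T1 xs" "sem s xs"]
    by (simp add: T sems_append sems_simps flip: plus_assoc)
qed

text \<open>Here and in the next two lemmas, additivity of an operation justifies the linear
  extension of a term former to sums.\<close>

lemma sems_map_Lam:
  assumes "FVs S \<subseteq> set (0 # map Suc xs)"
  shows "sems (map Lam S) xs = lam_op (ctx xs) (sems S (0 # map Suc xs))"
  using assms
proof (induction S)
  case Nil
  then show ?case by (simp add: sems_simps lam_op_zero)
next
  case (Cons s S)
  then show ?case
    using sem_el[of s "0 # map Suc xs"] sems_el[of S "0 # map Suc xs"]
    by (simp add: sems_simps sem_simps lam_op_add)
qed

lemma sems_apps:
  assumes "FVs S \<subseteq> set xs" "FVs T \<subseteq> set xs"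
  shows "sems (apps S T) xs = app_op (sems S xs) (sems T xs)"
  using assms(1)
proof (induction S)
  case Nil
  then show ?case using sems_el[OF assms(2)] by (simp add: apps_def sems_simps app_op_zero)
next
  case (Cons s S)
  then show ?case
    using sem_el[of s xs] sems_el[of S xs] sems_el[OF assms(2)]
    by (simp add: sems_simps sem_simps apps_def app_op_add[of "ctx xs"])
qed

lemma sems_difs:
  assumes "FVs S \<subseteq> set xs" "FVs T \<subseteq> set xs"
  shows "sems (difs S T) xs = dif_op (ctx xs) (sems S xs) (sems T xs)"
  using assms(1)
proof (induction S)
  case Nil
  then show ?case using sems_el[OF assms(2)] by (simp add: difs_def sems_simps dif_op_zero_left)
next
  case (Cons s S)
  have map: "sems (map (Dif s) T) xs = dif_op (ctx xs) (sem s xs) (sems T xs)"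
    using assms(2)
  proof (induction T)
    case Nil
    then show ?case
      using sem_el[of s xs] Cons.prems by (simp add: sems_simps dif_op_zero_right)
  next
    case (Cons t T)
    then show ?case
      using sem_el[of s xs] sem_el[of t xs] sems_el[of T xs] \<open>FVs (s # S) \<subseteq> set xs\<close>
      by (simp add: sems_simps sem_simps dif_op_add_right)
  qed
  have fv: "FVs (map (Dif s) T) \<subseteq> set xs" "FVs (difs S T) \<subseteq> set xs"
    using Cons.prems assms(2) FVs_difs[of S T] FVs_difs[of "[s]" T]
    by (simp_all add: difs_def[of "[s]"]) blast+
  have "difs (s # S) T = map (Dif s) T @ difs S T"
    by (simp add: difs_def)
  then show ?case
    using Cons sems_append[OF fv] map sem_el[of s xs] sems_el[of S xs] sems_el[OF assms(2)]
    by (simp add: sems_simps dif_op_add_left)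
qed

text \<open>Left additivity distributes the composition with \<open>r\<close> over a sum.
  \<open>F\<close> is kept abstract: it is substitution in \<open>sem_subst\<close> and a renaming,
  as a singleton, in \<open>sem_rename\<close>.\<close>

lemma sems_concat_comp:
  assumes r: "r \<in> Arr C" "Dom C r = ctx xs" "Cod C r = ctx ys"
    and "\<And>v. v \<in> set V \<Longrightarrow>
      FV v \<subseteq> set ys \<and> FVs (F v) \<subseteq> set xs \<and> sems (F v) xs = sem v ys \<odot> r"
  shows "sems (concat (map F V)) xs = sems V ys \<odot> r"
  using assms(4)
proof (induction V)
  case Nil
  then show ?case using r by (simp add: sems_simps)
next
  case (Cons v V)
  have fv: "FVs (F v) \<subseteq> set xs" "FVs (concat (map F V)) \<subseteq> set xs" "FV v \<subseteq> set ys"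
    "FVs V \<subseteq> set ys"
    using Cons.prems by (auto simp: FVs_def)
  have "sems (concat (map F V)) xs = sems V ys \<odot> r"
    by (rule Cons.IH) (use Cons.prems in simp)
  then show ?case
    using r sems_append[OF fv(1,2)] Cons.prems[of v] sem_el[OF fv(3)] sems_el[OF fv(4)]
    by (simp add: sems_simps)
qed

text \<open>The analogue for derivatives, where (D1) distributes \<open>D\<close> over the sum as
  well.\<close>

lemma sems_concat_diff:
  assumes d: "d \<in> Arr C" "Dom C d = ctx xs" "Cod C d = ctx xs"
    and "\<And>v. v \<in> set V \<Longrightarrow>
      FV v \<subseteq> set xs \<and> FVs (F v) \<subseteq> set xs \<and> sems (F v) xs = D (sem v xs) \<odot> \<langle>d, \<one> (ctx xs)\<rangle>"
  shows "sems (concat (map F V)) xs = D (sems V xs) \<odot> \<langle>d, \<one> (ctx xs)\<rangle>"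
  using assms(4)
proof (induction V)
  case Nil
  then show ?case using d by (simp add: sems_simps)
next
  case (Cons v V)
  have fv: "FVs (F v) \<subseteq> set xs" "FVs (concat (map F V)) \<subseteq> set xs" "FV v \<subseteq> set xs"
    "FVs V \<subseteq> set xs"
    using Cons.prems by (auto simp: FVs_def)
  have "sems (concat (map F V)) xs = D (sems V xs) \<odot> \<langle>d, \<one> (ctx xs)\<rangle>"
    by (rule Cons.IH) (use Cons.prems in simp)
  then show ?case
    using d sems_append[OF fv(1,2)] Cons.prems[of v] sem_el[OF fv(3)] sems_el[OF fv(4)]
    by (simp add: sems_simps)
qed

text \<open>\<open>r\<close> is constrained only by its components at the free variables. One
  induction thus covers the shift below a binder, weakening, and the passage from a named bound
  variable to index \<open>0\<close>.\<close>

lemma sem_rename: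
  assumes "FV s \<subseteq> set ys" "q ` FV s \<subseteq> set xs"
    and "r \<in> Arr C" "Dom C r = ctx xs" "Cod C r = ctx ys"
    and "\<And>y. y \<in> FV s \<Longrightarrow> prj ys y \<odot> r = prj xs (q y)"
  shows "sem (rename q s) xs = sem s ys \<odot> r"
  using assms
proof (induction s arbitrary: q xs ys r)
  case (Var y)
  then show ?case by simp
next
  case (Lam s)
  note [simp] = Lam.prems(3-5)
  \<comment> \<open>The morphism \<open>r\<close> extended by the identity on the bound
    variable.\<close>
  let ?r = "\<langle>r \<odot> \<pi>\<^sub>1 (ctx xs) U, \<pi>\<^sub>2 (ctx xs) U\<rangle>"
  have fv: "FV s \<subseteq> set (0 # map Suc ys)"
    by (rule FV_Lam_subset) (rule Lam.prems(1))
  have "sem (rename (up q) s) (0 # map Suc xs) = sem s (0 # map Suc ys) \<odot> ?r"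
  proof (rule Lam.IH)
    show "up q ` FV s \<subseteq> set (0 # map Suc xs)"
    proof
      fix z assume "z \<in> up q ` FV s"
      then obtain y where "y \<in> FV s" "z = up q y" by auto
      then show "z \<in> set (0 # map Suc xs)" using Lam.prems(2) by (cases y) auto
    qed
    fix y assume y: "y \<in> FV s"
    show "prj (0 # map Suc ys) y \<odot> ?r = prj (0 # map Suc xs) (up q y)"
    proof (cases y)
      case (Suc m)
      with y Lam.prems(1) prj_el[of m ys] have m: "el (ctx ys) (prj ys m)" by auto
      have "prj ys m \<odot> (r \<odot> \<pi>\<^sub>1 (ctx xs) U) = prj xs (q m) \<odot> \<pi>\<^sub>1 (ctx xs) U"
        by (rule comp_reassoc) (use m Lam.prems(6) y Suc in simp_all)
      with m Suc show ?thesis by simp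
    qed simp
  qed (use fv in simp_all)
  then show ?case
    using sem_el[OF fv] by (simp add: sem_simps lam_op_comp[of _ "ctx xs"])
next
  case (App s V)
  note [simp] = App.prems(3-5)
  have fv: "FV s \<subseteq> set ys" "FVs V \<subseteq> set ys" "q ` FVs V \<subseteq> set xs"
    using App.prems(1,2) by (auto simp: FVs_def)
  have s: "sem (rename q s) xs = sem s ys \<odot> r"
    by (rule App.IH(1)) (use App.prems in auto)
  \<comment> \<open>A renamed sum is written as a concatenation of singletons to fit
    \<open>sems_concat_comp\<close>.\<close>
  have "sems (concat (map (\<lambda>v. [rename q v]) V)) xs = sems V ys \<odot> r"
  proof (rule sems_concat_comp)
    fix v assume v: "v \<in> set V"
    then have fvv: "FV v \<subseteq> set ys" "q ` FV v \<subseteq> set xs"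
      using fv by (simp_all add: FVs_def, blast+)
    have "sem (rename q v) xs = sem v ys \<odot> r"
      by (rule App.IH(2)[OF v]) (use App.prems fvv v in auto)
    then show "FV v \<subseteq> set ys \<and> FVs [rename q v] \<subseteq> set xs \<and>
        sems [rename q v] xs = sem v ys \<odot> r"
      using fvv by (simp add: FV_rename sems_singleton)
  qed simp_all
  then have "sems (map (rename q) V) xs = sems V ys \<odot> r"
    by (simp add: concat_map_singleton)
  then show ?case
    using s sem_el[OF fv(1)] sems_el[OF fv(2)] by (simp add: sem_simps app_op_comp[of "ctx ys" "ctx xs"])
next
  case (Dif s t)
  have "sem (rename q s) xs = sem s ys \<odot> r" "sem (rename q t) xs = sem t ys \<odot> r"
    by (rule Dif.IH; use Dif.prems in auto)+
  then show ?case
    using Dif.prems(1,3-5) sem_el[of s ys] sem_el[of t ys] by (simp add: sem_simps dif_op_comp[of _ "ctx xs"])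
qed

lemma sems_rename:
  assumes "FVs S \<subseteq> set ys" "q ` FVs S \<subseteq> set xs"
    and "r \<in> Arr C" "Dom C r = ctx xs" "Cod C r = ctx ys"
    and "\<And>y. y \<in> FVs S \<Longrightarrow> prj ys y \<odot> r = prj xs (q y)"
  shows "sems (map (rename q) S) xs = sems S ys \<odot> r"
proof -
  have "sems (concat (map (\<lambda>v. [rename q v]) S)) xs = sems S ys \<odot> r"
  proof (rule sems_concat_comp)
    fix v assume v: "v \<in> set S"
    then have fvv: "FV v \<subseteq> FVs S"
      by (auto simp: FVs_def)
    have "sem (rename q v) xs = sem v ys \<odot> r"
      by (rule sem_rename) (use assms fvv in blast)+
    moreover have "FV (rename q v) \<subseteq> set xs"
      unfolding FV_rename using assms(2) fvv by blast
    ultimately show "FV v \<subseteq> set ys \<and> FVs [rename q v] \<subseteq> set xs \<and>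
        sems [rename q v] xs = sem v ys \<odot> r"
      using fvv assms(1) by (simp add: sems_singleton)
  qed (use assms in simp_all)
  then show ?thesis
    by (simp add: concat_map_singleton)
qed

lemma sems_shift:
  assumes "FVs T \<subseteq> set xs"
  shows "sems (map (rename Suc) T) (0 # map Suc xs) = sems T xs \<odot> \<pi>\<^sub>1 (ctx xs) U"
  by (rule sems_rename) (use assms in auto)

text \<open>The last hypothesis says that \<open>r\<close> supplies \<open>T\<close> at
  \<open>x\<close> and a projection elsewhere. An arbitrary such \<open>r\<close> is needed for the
  induction: below a binder \<open>x\<close> is no longer the last variable of the context.\<close>

lemma sem_subst:
  assumes "FV s \<subseteq> set ys" "FV s - {x} \<subseteq> set xs" "FVs T \<subseteq> set xs"
    and "r \<in> Arr C" "Dom C r = ctx xs" "Cod C r = ctx ys"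
    and "\<And>y. y \<in> FV s \<Longrightarrow> prj ys y \<odot> r = (if y = x then sems T xs else prj xs y)"
  shows "sems (subst s x T) xs = sem s ys \<odot> r"
  using assms
proof (induction s arbitrary: x T xs ys r)
  case (Var y)
  then show ?case using sems_singleton[of "Var y" xs] by auto
next
  case (Lam s)
  note [simp] = Lam.prems(4-6)
  let ?r = "\<langle>r \<odot> \<pi>\<^sub>1 (ctx xs) U, \<pi>\<^sub>2 (ctx xs) U\<rangle>"
  let ?S = "subst s (Suc x) (map (rename Suc) T)"
  have fv: "FV s \<subseteq> set (0 # map Suc ys)"
    by (rule FV_Lam_subset) (rule Lam.prems(1))
  have fv': "FV s - {Suc x} \<subseteq> set (0 # map Suc xs)" "FVs (map (rename Suc) T) \<subseteq> set (0 # map Suc xs)"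
  proof
    fix y assume "y \<in> FV s - {Suc x}"
    then show "y \<in> set (0 # map Suc xs)" using Lam.prems(2) by (cases y) auto
  qed (use Lam.prems(3) in \<open>auto simp: FVs_map_rename\<close>)
  have T: "el (ctx xs) (sems T xs)"
    by (rule sems_el) (rule Lam.prems(3))
  have "sems ?S (0 # map Suc xs) = sem s (0 # map Suc ys) \<odot> ?r"
  proof (rule Lam.IH)
    fix y assume y: "y \<in> FV s"
    show "prj (0 # map Suc ys) y \<odot> ?r = (if y = Suc x
        then sems (map (rename Suc) T) (0 # map Suc xs) else prj (0 # map Suc xs) y)"
    proof (cases y)
      case (Suc m)
      with y Lam.prems(1) prj_el[of m ys] have m: "el (ctx ys) (prj ys m)" by auto
      have "prj ys m \<odot> (r \<odot> \<pi>\<^sub>1 (ctx xs) U) =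
          (if m = x then sems T xs else prj xs m) \<odot> \<pi>\<^sub>1 (ctx xs) U"
        by (rule comp_reassoc) (use m Lam.prems(7) y Suc in simp_all)
      \<comment> \<open>At \<open>x\<close>, composition with the first projection is the weakening
        of \<open>T\<close> that the syntax performs by \<open>rename Suc\<close>.\<close>
      with m Suc show ?thesis
        using Lam.prems(3) by (cases "m = x") (simp_all add: sems_shift)
    qed simp
  qed (use fv fv' in simp_all)
  moreover have "FVs ?S \<subseteq> set (0 # map Suc xs)"
    using FVs_subst[of s "Suc x" "map (rename Suc) T"] fv' by blast
  ultimately show ?case
    using sem_el[OF fv] by (simp add: sems_map_Lam sem_simps lam_op_comp[of _ "ctx xs"])
next
  case (App s V)
  note [simp] = App.prems(4-6)
  let ?V = "concat (map (\<lambda>v. subst v x T) V)"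
  have fv: "FV s \<subseteq> set ys" "FVs V \<subseteq> set ys"
    using App.prems(1) by (auto simp: FVs_def)
  have s: "sems (subst s x T) xs = sem s ys \<odot> r"
    by (rule App.IH(1)) (use App.prems in auto)
  have V: "FV v \<subseteq> set ys \<and> FVs (subst v x T) \<subseteq> set xs \<and> sems (subst v x T) xs = sem v ys \<odot> r"
    if v: "v \<in> set V" for v
  proof (intro conjI)
    have FV_v: "FV v \<subseteq> FV (App s V)"
      using v by auto
    show "FV v \<subseteq> set ys" "FVs (subst v x T) \<subseteq> set xs"
      using v App.prems(1-3) FVs_subst[of v x T] by auto
    show "sems (subst v x T) xs = sem v ys \<odot> r"
      by (rule App.IH(2)[OF v]) (use App.prems FV_v in blast)+
  qed
  have "sems ?V xs = sems V ys \<odot> r"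
    by (rule sems_concat_comp) (use V in simp_all)
  moreover have "FVs (subst s x T) \<subseteq> set xs" "FVs ?V \<subseteq> set xs"
    using App.prems(2,3) FVs_subst[of s x T] V by (simp_all, blast+)
  ultimately show ?case
    using s sem_el[OF fv(1)] sems_el[OF fv(2)]
    by (simp add: sem_simps sems_apps app_op_comp[of "ctx ys" "ctx xs"])
next
  case (Dif s t)
  have "sems (subst s x T) xs = sem s ys \<odot> r" "sems (subst t x T) xs = sem t ys \<odot> r"
    by (rule Dif.IH; use Dif.prems in auto)+
  moreover have "FVs (subst s x T) \<subseteq> set xs" "FVs (subst t x T) \<subseteq> set xs"
    using Dif.prems(2,3) FVs_subst[of s x T] FVs_subst[of t x T] by auto
  ultimately show ?case
    using Dif.prems(1,4-6) sem_el[of s ys] sem_el[of t ys]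
    by (simp add: sem_simps sems_difs dif_op_comp[of _ "ctx xs"])
qed

text \<open>Differential substitution is the derivative of the interpretation along the direction
  that is \<open>T\<close> in the component of \<open>x\<close> and \<open>0\<close> in all others. Unlike \<open>\<star>\<close>, which
  differentiates with respect to the last variable only, this description is stable under
  extending the context.\<close>

lemma sem_dsubst:
  assumes "FV s \<subseteq> set xs" "FVs T \<subseteq> set xs"
    and "d \<in> Arr C" "Dom C d = ctx xs" "Cod C d = ctx xs"
    and "\<And>y. y \<in> FV s \<Longrightarrow> prj xs y \<odot> d = (if y = x then sems T xs else \<zero> (ctx xs) U)"
  shows "sems (dsubst s x T) xs = D (sem s xs) \<odot> \<langle>d, \<one> (ctx xs)\<rangle>"
  using assms
proof (induction s arbitrary: x T xs d)
  case (Var y)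
  \<comment> \<open>Projections are linear. Both \<open>d\<close> and \<open>v\<close> are general
    because the induction on the context composes each of them with a first projection.\<close>
  have diff_prj: "D (prj xs y) \<odot> \<langle>d, v\<rangle> = prj xs y \<odot> d"
    if "y \<in> set xs" "d \<in> Arr C" "Cod C d = ctx xs" "v \<in> Arr C" "Cod C v = ctx xs"
      "Dom C d = Dom C v" for xs d v
    using that prj_el by (induction xs arbitrary: d v) auto
  have "D (prj xs y) \<odot> \<langle>d, \<one> (ctx xs)\<rangle> = prj xs y \<odot> d"
    by (rule diff_prj) (use Var.prems in simp_all)
  then show ?case
    using Var.prems by (simp add: sems_simps)
next
  case (Lam s)
  note [simp] = Lam.prems(3-5)
  let ?xs = "0 # map Suc xs" and ?T = "map (rename Suc) T"
  \<comment> \<open>Direction zero at the bound variable, as in \<open>diff_lam_op\<close>: the term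
    is not differentiated with respect to it.\<close>
  let ?d = "\<langle>d \<odot> \<pi>\<^sub>1 (ctx xs) U, \<zero> (ctx xs \<otimes> U) U\<rangle>"
  have fv: "FV s \<subseteq> set ?xs" "FVs ?T \<subseteq> set ?xs"
    using FV_Lam_subset[OF Lam.prems(1)] Lam.prems(2) by (auto simp: FVs_map_rename)
  have "sems (dsubst s (Suc x) ?T) ?xs = D (sem s ?xs) \<odot> \<langle>?d, \<one> (ctx ?xs)\<rangle>"
  proof (rule Lam.IH)
    fix y assume y: "y \<in> FV s"
    show "prj ?xs y \<odot> ?d = (if y = Suc x then sems ?T ?xs else \<zero> (ctx ?xs) U)"
    proof (cases y)
      case (Suc m)
      with y Lam.prems(1) prj_el[of m xs] have m: "el (ctx xs) (prj xs m)" by auto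
      have "prj xs m \<odot> (d \<odot> \<pi>\<^sub>1 (ctx xs) U) =
          (if m = x then sems T xs else \<zero> (ctx xs) U) \<odot> \<pi>\<^sub>1 (ctx xs) U"
        by (rule comp_reassoc) (use m Lam.prems(6) y Suc in simp_all)
      with m Suc show ?thesis
        using Lam.prems(2) by (cases "m = x") (simp_all add: sems_shift)
    qed simp
  qed (use fv in simp_all)
  moreover have "FVs (dsubst s (Suc x) ?T) \<subseteq> set ?xs"
    using FVs_dsubst[of s "Suc x" ?T] fv by blast
  ultimately show ?case
    using sem_el[OF fv(1)] by (simp add: sems_map_Lam sem_simps diff_lam_op)
next
  case (App s V)
  note [simp] = App.prems(3-5)
  let ?V = "concat (map (\<lambda>v. dsubst v x T) V)"
  have fv: "FV s \<subseteq> set xs" "FVs V \<subseteq> set xs"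
    using App.prems(1) by (auto simp: FVs_def)
  have s: "sems (dsubst s x T) xs = D (sem s xs) \<odot> \<langle>d, \<one> (ctx xs)\<rangle>"
    by (rule App.IH(1)) (use App.prems in auto)
  have V: "FV v \<subseteq> set xs \<and> FVs (dsubst v x T) \<subseteq> set xs \<and>
      sems (dsubst v x T) xs = D (sem v xs) \<odot> \<langle>d, \<one> (ctx xs)\<rangle>"
    if v: "v \<in> set V" for v
  proof (intro conjI)
    have FV_v: "FV v \<subseteq> FV (App s V)"
      using v by auto
    show "FV v \<subseteq> set xs" "FVs (dsubst v x T) \<subseteq> set xs"
      using v App.prems(1,2) FVs_dsubst[of v x T] by (simp_all, blast+)
    show "sems (dsubst v x T) xs = D (sem v xs) \<odot> \<langle>d, \<one> (ctx xs)\<rangle>"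
      by (rule App.IH(2)[OF v]) (use App.prems FV_v in blast)+
  qed
  have V': "sems ?V xs = D (sems V xs) \<odot> \<langle>d, \<one> (ctx xs)\<rangle>"
    by (rule sems_concat_diff) (use V in simp_all)
  have fv': "FVs (dsubst s x T) \<subseteq> set xs" "FVs ?V \<subseteq> set xs"
    using App.prems(2) fv FVs_dsubst[of s x T] V by (simp_all, blast+)
  have fv'': "FVs (apps (dsubst s x T) V) \<subseteq> set xs" "FVs (difs [s] ?V) \<subseteq> set xs"
    "FVs (apps (difs [s] ?V) V) \<subseteq> set xs"
    using fv fv' FVs_apps[of "dsubst s x T" V] FVs_difs[of "[s]" ?V] FVs_apps[of "difs [s] ?V" V]
    by (simp_all del: FVs_simps(4)) blast+
  \<comment> \<open>The two summands of the syntactic clause are those of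
    \<open>diff_app_op\<close>.\<close>
  have "sems (dsubst (App s V) x T) xs =
      app_op (sems (dsubst s x T) xs) (sems V xs) \<oplus>
      app_op (dif_op (ctx xs) (sem s xs) (sems ?V xs)) (sems V xs)"
    using fv fv' fv''
    by (simp add: sems_append sems_apps sems_difs sems_singleton del: FVs_simps(4))
  also have "\<dots> = D (app_op (sem s xs) (sems V xs)) \<odot> \<langle>d, \<one> (ctx xs)\<rangle>"
    unfolding s V' using sem_el[OF fv(1)] sems_el[OF fv(2)] by (simp add: diff_app_op)
  finally show ?case
    by (simp add: sem_simps)
next
  case (Dif s t)
  have fv: "FV s \<subseteq> set xs" "FV t \<subseteq> set xs"
    using Dif.prems(1) by auto
  have "sems (dsubst s x T) xs = D (sem s xs) \<odot> \<langle>d, \<one> (ctx xs)\<rangle>"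
    "sems (dsubst t x T) xs = D (sem t xs) \<odot> \<langle>d, \<one> (ctx xs)\<rangle>"
    by (rule Dif.IH; use Dif.prems in auto)+
  moreover have fv': "FVs (dsubst s x T) \<subseteq> set xs" "FVs (dsubst t x T) \<subseteq> set xs"
    using Dif.prems(1,2) FVs_dsubst[of s x T] FVs_dsubst[of t x T] by auto
  moreover have "FVs (difs (dsubst s x T) [t]) \<subseteq> set xs" "FVs (difs [s] (dsubst t x T)) \<subseteq> set xs"
    using fv fv' FVs_difs[of "dsubst s x T" "[t]"] FVs_difs[of "[s]" "dsubst t x T"] by auto
  ultimately show ?case
    using Dif.prems(3-5) fv sem_el[OF fv(1)] sem_el[OF fv(2)]
    by (simp add: sem_simps sems_append sems_difs sems_singleton diff_dif_op)
qed

section \<open>Soundness\<close>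

lemma context_morphism:
  assumes "set ys \<subseteq> set xs"
  obtains r where "r \<in> Arr C" "Dom C r = ctx xs" "Cod C r = ctx ys"
    "\<And>y. y \<in> set ys \<Longrightarrow> prj ys y \<odot> r = prj xs y"
  using assms
proof (induction ys arbitrary: thesis)
  case Nil
  then show ?case using terminal_unique[of "ctx xs"] by (auto simp: hom_iff)
next
  case (Cons y ys)
  obtain r where r: "r \<in> Arr C" "Dom C r = ctx xs" "Cod C r = ctx ys"
    "\<And>y. y \<in> set ys \<Longrightarrow> prj ys y \<odot> r = prj xs y"
    using Cons by (metis set_subset_Cons subset_trans)
  have y: "el (ctx xs) (prj xs y)"
    using Cons.prems prj_el by simp
  show ?case
  \<comment> \<open>The morphism is the tuple of those projections of \<open>xs\<close> that
    \<open>ys\<close> selects, built up from the arrow into the terminal object.\<close>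
  proof (rule Cons.prems(1))
    fix z assume "z \<in> set (y # ys)"
    then show "prj (y # ys) z \<odot> \<langle>r, prj xs y\<rangle> = prj xs z"
      using r y prj_el[of z ys] by auto
  qed (use r y in simp_all)
qed

text \<open>\<open>Th\<close> asks for equality in some adequate context only. Composition with a
  morphism of contexts carries it to every larger one, so that several equations can be compared in
  a common context.\<close>

lemma sems_weaken:
  assumes "sems S xs = sems T xs" "FVs S \<subseteq> set xs" "FVs T \<subseteq> set xs" "set xs \<subseteq> set zs"
  shows "sems S zs = sems T zs"
proof -
  obtain r where r: "r \<in> Arr C" "Dom C r = ctx zs" "Cod C r = ctx xs"
    "\<And>y. y \<in> set xs \<Longrightarrow> prj xs y \<odot> r = prj zs y"
    using context_morphism[OF assms(4)] by metis
  have "sems V zs = sems V xs \<odot> r" if "FVs V \<subseteq> set xs" for V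
  proof -
    \<comment> \<open>Weakening is renaming along the identity of variables.\<close>
    have "sems (map (rename id) V) zs = sems V xs \<odot> r"
      by (rule sems_rename) (use that assms(4) r in auto)
    then show ?thesis
      by (simp add: rename_id map_idI)
  qed
  with assms show ?thesis by simp
qed

text \<open>In contrast to \<open>interp_lam\<close>, \<open>x\<close> may occur in
  \<open>xs\<close>: \<open>bind x\<close> and the projections of \<open>x # xs\<close> both resolve
  \<open>x\<close> to the innermost binding.\<close>

lemma sem_lam:
  assumes "FV s \<subseteq> insert x (set xs)"
  shows "sem (lam x s) xs = lam_op (ctx xs) (sem s (x # xs))"
proof -
  \<comment> \<open>The named and the indexed context have the same object, so the renaming is
    interpreted along its identity.\<close>
  have "sem (rename (bind x) s) (0 # map Suc xs) = sem s (x # xs) \<odot> \<one> (ctx xs \<otimes> U)"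
  proof (rule sem_rename)
    fix y assume "y \<in> FV s"
    then show "prj (x # xs) y \<odot> \<one> (ctx xs \<otimes> U) = prj (0 # map Suc xs) (bind x y)"
      using assms prj_el[of y xs] by (auto simp: bind_def)
  qed (use assms in \<open>auto simp: bind_def\<close>)
  then show ?thesis
    using assms sem_el[of s "x # xs"] by (simp add: lam_def sem_simps)
qed

lemma sems_lams:
  assumes "FVs S \<subseteq> insert x (set xs)"
  shows "sems (lams x S) xs = lam_op (ctx xs) (sems S (x # xs))"
  using assms
proof (induction S)
  case Nil
  then show ?case by (simp add: lams_def sems_simps lam_op_zero)
next
  case (Cons s S)
  then show ?case
    using sem_el[of s "x # xs"] sems_el[of S "x # xs"]
    by (simp add: lams_def sems_simps sem_lam lam_op_add)
qed

section \<open>Soundness of the identifications of terms\<close>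

lemma sem_Difn_cong:
  assumes "sem s xs = sem t xs"
  shows "sem (Difn s us) xs = sem (Difn t us) xs"
  using assms by (induction us arbitrary: s t) (simp_all add: sem_simps)

text \<open>\<open>t\<close> travels to the front by adjacent exchanges, each an instance of
  \<open>dif_op_commute\<close>.\<close>

lemma sem_Difn_move:
  assumes "FV s \<subseteq> set xs" "FVs us \<subseteq> set xs" "FV t \<subseteq> set xs"
  shows "sem (Difn s (us @ t # vs)) xs = sem (Difn s (t # us @ vs)) xs"
  using assms
proof (induction us arbitrary: s)
  case (Cons u us)
  have "sem (Difn (Dif s u) (us @ t # vs)) xs = sem (Difn (Dif (Dif s u) t) (us @ vs)) xs"
    using Cons by simp
  also have "\<dots> = sem (Difn (Dif (Dif s t) u) (us @ vs)) xs"
    using Cons.prems sem_el[of s xs] sem_el[of t xs] sem_el[of u xs]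
    by (intro sem_Difn_cong) (simp add: sem_simps dif_op_commute)
  finally show ?case by simp
qed simp

lemma sem_Difn_mset:
  assumes "mset ts = mset us" "FV s \<subseteq> set xs" "FVs ts \<subseteq> set xs"
  shows "sem (Difn s ts) xs = sem (Difn s us) xs"
  using assms
proof (induction ts arbitrary: s us)
  case Nil
  then show ?case by simp
next
  case (Cons t ts)
  then have "t \<in> set us"
    by (metis list.set_intros(1) set_mset_mset)
  then obtain us1 us2 where us: "us = us1 @ t # us2"
    by (meson split_list)
  with Cons.prems have eq: "mset ts = mset (us1 @ us2)"
    by simp
  have "FVs us \<subseteq> set xs"
    using Cons.prems(2-) FVs_mset[OF Cons.prems(1)] by auto
  then have "sem (Difn s us) xs = sem (Difn (Dif s t) (us1 @ us2)) xs"
    using Cons.prems sem_Difn_move[of s xs us1 t us2] by (simp add: us)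
  with Cons.IH[OF eq, of "Dif s t"] Cons.prems show ?case by simp
qed

text \<open>Equality of free variables is part of the induction because symmetry and transitivity
  must transfer adequacy of a context from one side to the other.\<close>

lemma sem_eq:
  shows "simple_eq s t \<Longrightarrow> FV s = FV t \<and> (\<forall>xs. FV s \<subseteq> set xs \<longrightarrow> sem s xs = sem t xs)"
    and "dterm_eq S T \<Longrightarrow> FVs S = FVs T \<and> (\<forall>xs. FVs S \<subseteq> set xs \<longrightarrow> sems S xs = sems T xs)"
proof (induction rule: simple_eq_dterm_eq.inducts)
  case (seq_Lam s s')
  have "sem (Lam s) xs = sem (Lam s') xs" if "FV (Lam s) \<subseteq> set xs" for xs
    using seq_Lam FV_Lam_subset[OF that] by (simp add: sem_simps)
  with seq_Lam show ?case by simp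
next
  case (seq_App s s' T T')
  then show ?case by (simp add: sem_simps FV_App del: FV.simps)
next
  case (seq_Dif s s' t t')
  then show ?case by (simp add: sem_simps)
next
  case (seq_perm ts us s)
  then have "FVs ts = FVs us" by (rule FVs_mset)
  with seq_perm show ?case by (auto simp: FV_Difn intro: sem_Difn_mset)
next
  case (teq_Cons s s' T T')
  then show ?case by (simp add: sems_simps)
next
  case (teq_comm S T)
  then have "FVs S = FVs T" by (rule FVs_mset)
  with teq_comm show ?case by (auto intro: sems_mset)
qed auto

section \<open>Soundness of the two beta rules\<close>

lemma beta_sound:
  assumes "FV s - {x} \<subseteq> set xs" "FVs T \<subseteq> set xs"
  shows "sem (App (lam x s) T) xs = sems (subst s x T) xs"
proof -
  have fv: "FV s \<subseteq> set (x # xs)"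
    using assms by auto
  have T: "el (ctx xs) (sems T xs)"
    by (rule sems_el) (rule assms)
  have "sem (App (lam x s) T) xs = sem s (x # xs) \<odot> \<langle>\<one> (ctx xs), sems T xs\<rangle>"
    using fv sem_el[OF fv] T by (simp add: sem_simps sem_lam app_op_lam)
  \<comment> \<open>The pairing of the identity with \<open>T\<close> has component \<open>T\<close>
    at \<open>x\<close> and plain projections elsewhere, as \<open>sem_subst\<close>
    requires.\<close>
  also have "\<dots> = sems (subst s x T) xs"
  proof (rule sem_subst[symmetric])
    fix y assume "y \<in> FV s"
    then show "prj (x # xs) y \<odot> \<langle>\<one> (ctx xs), sems T xs\<rangle> = (if y = x then sems T xs else prj xs y)"
      using fv T prj_el[of y xs] by auto
  qed (use fv assms T in simp_all)
  finally show ?thesis .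
qed

text \<open>By \<open>dif_op_lam\<close> the left side abstracts a \<star>, which is the derivative
  in the direction that is \<open>t\<close> at \<open>x\<close> and zero elsewhere, the situation of
  \<open>sem_dsubst\<close>. With \<open>x\<close> outside \<open>xs\<close>, weakening
  \<open>t\<close> to \<open>x # xs\<close> captures nothing.\<close>

lemma beta_D_sound:
  assumes "FV s \<subseteq> insert x (set xs)" "FV t \<subseteq> set xs" "x \<notin> set xs"
  shows "sem (Dif (lam x s) t) xs = sems (lams x (dsubst s x [t])) xs"
proof -
  let ?X = "ctx xs" and ?xs = "x # xs"
  have fv: "FV s \<subseteq> set ?xs" "FVs [t] \<subseteq> set ?xs"
    using assms by auto
  have t: "el ?X (sem t xs)"
    by (rule sem_el) (rule assms)
  have "sems (map (rename id) [t]) ?xs = sems [t] xs \<odot> \<pi>\<^sub>1 ?X U"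
    by (rule sems_rename) (use assms in auto)
  then have t': "sems [t] ?xs = sem t xs \<odot> \<pi>\<^sub>1 ?X U"
    using assms(2) by (simp add: rename_id sems_singleton)
  have "sems (dsubst s x [t]) ?xs =
      D (sem s ?xs) \<odot> \<langle>\<langle>\<zero> (?X \<otimes> U) ?X, sem t xs \<odot> \<pi>\<^sub>1 ?X U\<rangle>, \<one> (ctx ?xs)\<rangle>"
  proof (rule sem_dsubst)
    fix y assume y: "y \<in> FV s"
    show "prj ?xs y \<odot> \<langle>\<zero> (?X \<otimes> U) ?X, sem t xs \<odot> \<pi>\<^sub>1 ?X U\<rangle> =
        (if y = x then sems [t] ?xs else \<zero> (ctx ?xs) U)"
      using y fv(1) t t' prj_el[of y xs] prj_zero[of y xs "?X \<otimes> U"] by auto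
  qed (use fv t in simp_all)
  also have "\<dots> = sem s ?xs \<star> sem t xs"
    using t by (simp add: star_eq[of _ ?X U])
  finally have "sem s ?xs \<star> sem t xs = sems (dsubst s x [t]) ?xs" ..
  moreover have "FVs (dsubst s x [t]) \<subseteq> insert x (set xs)"
    using FVs_dsubst[of s x "[t]"] fv by auto
  ultimately show ?thesis
    using assms sem_el[OF fv(1)] by (simp add: sem_simps sem_lam sems_lams dif_op_lam)
qed

section \<open>Closure properties of the equational theory\<close>

abbreviation "theory_of \<equiv> Th C U \<A> \<l>"

text \<open>\<open>Th\<close> requires a repetition-free context; \<open>remdups xs\<close> has the
  same variables, so equality transfers to it by \<open>sems_weaken\<close>.\<close>

lemma theory_ofI:
  assumes "FVs S \<subseteq> set xs" "FVs T \<subseteq> set xs" "sems S xs = sems T xs"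
  shows "(S, T) \<in> theory_of"
proof -
  have "sems S (remdups xs) = sems T (remdups xs)"
    by (rule sems_weaken[OF assms(3,1,2)]) simp
  then show ?thesis
    unfolding Th_def using assms by (intro CollectI case_prodI exI[of _ "remdups xs"]) simp
qed

text \<open>Equality is delivered in all larger contexts at once, including ones with repetitions
  such as \<open>xs @ ys\<close>.\<close>

lemma theory_ofE:
  assumes "(S, T) \<in> theory_of"
  obtains xs where "FVs S \<subseteq> set xs" "FVs T \<subseteq> set xs"
    "\<And>zs. set xs \<subseteq> set zs \<Longrightarrow> sems S zs = sems T zs"
  using assms sems_weaken unfolding Th_def by blast

lemma FVs_list:
  obtains xs where "FVs S = set xs"
  using finite_list[OF finite_FVs] by metis

lemma theory_of_equiv: "equiv UNIV theory_of"
proof (rule equivI)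
  show "refl theory_of"
    by (rule refl_onI) (metis FVs_list subset_refl theory_ofI)
  show "sym theory_of"
    by (rule symI) (metis theory_ofE theory_ofI subset_refl)
  show "trans theory_of"
  proof (rule transI)
    fix S T V assume "(S, T) \<in> theory_of" "(T, V) \<in> theory_of"
    then obtain xs ys where
      "FVs S \<subseteq> set xs" "\<And>zs. set xs \<subseteq> set zs \<Longrightarrow> sems S zs = sems T zs"
      "FVs V \<subseteq> set ys" "\<And>zs. set ys \<subseteq> set zs \<Longrightarrow> sems T zs = sems V zs"
      by (metis theory_ofE)
    \<comment> \<open>The two equations may be witnessed in different contexts; both hold in the
      concatenation.\<close>
    then show "(S, V) \<in> theory_of"
      by (intro theory_ofI[of S "xs @ ys" V]) auto
  qed
qed simp_all

lemma theory_of_dterm_eq: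
  assumes "dterm_eq S T"
  shows "(S, T) \<in> theory_of"
  by (metis FVs_list sem_eq(2)[OF assms] subset_refl theory_ofI)

lemma theory_of_lam:
  assumes "([s], S) \<in> theory_of"
  shows "([lam x s], lams x S) \<in> theory_of"
proof -
  obtain xs where xs: "FVs [s] \<subseteq> set xs" "FVs S \<subseteq> set xs"
    and eq: "\<And>zs. set xs \<subseteq> set zs \<Longrightarrow> sems [s] zs = sems S zs"
    using theory_ofE[OF assms] by metis
  have fv: "FV s \<subseteq> insert x (set xs)" "FVs S \<subseteq> insert x (set xs)"
    using xs by auto
  show ?thesis
  proof (rule theory_ofI[of _ xs])
    \<comment> \<open>If \<open>x\<close> already lies in \<open>xs\<close>, the context
      \<open>x # xs\<close> shadows it, which \<open>sems_lams\<close> permits.\<close>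
    show "sems [lam x s] xs = sems (lams x S) xs"
      using sems_lams[of "[s]" x xs] sems_lams[OF fv(2)] fv eq[of "x # xs"]
      by (simp add: lams_def subset_insertI)
  qed (use xs in \<open>auto simp: FV_lam FVs_lams\<close>)
qed

lemma theory_of_App:
  assumes "([s], S) \<in> theory_of" "(T, V) \<in> theory_of"
  shows "([App s T], apps S V) \<in> theory_of"
proof -
  obtain xs ys where xs: "FVs [s] \<subseteq> set xs" "FVs S \<subseteq> set xs" "FVs T \<subseteq> set ys" "FVs V \<subseteq> set ys"
    and eq: "sems [s] (xs @ ys) = sems S (xs @ ys)" "sems T (xs @ ys) = sems V (xs @ ys)"
    using assms by (metis theory_ofE Un_upper1 Un_upper2 set_append)
  have fv: "FV s \<subseteq> set (xs @ ys)" "FVs S \<subseteq> set (xs @ ys)" "FVs T \<subseteq> set (xs @ ys)"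
    "FVs V \<subseteq> set (xs @ ys)"
    using xs by auto
  show ?thesis
  proof (rule theory_ofI)
    show "FVs [App s T] \<subseteq> set (xs @ ys)" "FVs (apps S V) \<subseteq> set (xs @ ys)"
      using fv FVs_apps[of S V] by (simp_all add: FV_App del: FV.simps) blast
    then show "sems [App s T] (xs @ ys) = sems (apps S V) (xs @ ys)"
      using fv eq by (simp add: sems_singleton sem_simps sems_apps del: set_append FV.simps)
  qed
qed

lemma theory_of_Dif:
  assumes "([s], S) \<in> theory_of" "([u], V) \<in> theory_of"
  shows "([Dif s u], difs S V) \<in> theory_of"
proof -
  obtain xs ys where xs: "FVs [s] \<subseteq> set xs" "FVs S \<subseteq> set xs" "FVs [u] \<subseteq> set ys" "FVs V \<subseteq> set ys"
    and eq: "sems [s] (xs @ ys) = sems S (xs @ ys)" "sems [u] (xs @ ys) = sems V (xs @ ys)"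
    using assms by (metis theory_ofE Un_upper1 Un_upper2 set_append)
  have fv: "FV s \<subseteq> set (xs @ ys)" "FVs S \<subseteq> set (xs @ ys)" "FV u \<subseteq> set (xs @ ys)"
    "FVs V \<subseteq> set (xs @ ys)"
    using xs by auto
  show ?thesis
  proof (rule theory_ofI)
    show "FVs [Dif s u] \<subseteq> set (xs @ ys)" "FVs (difs S V) \<subseteq> set (xs @ ys)"
      using fv FVs_difs[of S V] by auto
    then show "sems [Dif s u] (xs @ ys) = sems (difs S V) (xs @ ys)"
      using fv eq by (simp add: sems_singleton sem_simps sems_difs del: set_append FV.simps)
  qed
qed

lemma theory_of_append:
  assumes "(S, S') \<in> theory_of" "(T, T') \<in> theory_of"
  shows "(S @ T, S' @ T') \<in> theory_of"
proof -
  obtain xs ys where xs: "FVs S \<subseteq> set xs" "FVs S' \<subseteq> set xs" "FVs T \<subseteq> set ys" "FVs T' \<subseteq> set ys"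
    and eq: "sems S (xs @ ys) = sems S' (xs @ ys)" "sems T (xs @ ys) = sems T' (xs @ ys)"
    using assms by (metis theory_ofE Un_upper1 Un_upper2 set_append)
  have fv: "FVs S \<subseteq> set (xs @ ys)" "FVs S' \<subseteq> set (xs @ ys)" "FVs T \<subseteq> set (xs @ ys)"
    "FVs T' \<subseteq> set (xs @ ys)"
    using xs by auto
  with eq show ?thesis
    by (intro theory_ofI[of _ "xs @ ys"]) (simp_all add: sems_append del: set_append)
qed

lemma theory_of_concat:
  assumes "list_all2 (\<lambda>s S. ([s], S) \<in> theory_of) ss Ss"
  shows "(ss, concat Ss) \<in> theory_of"
  using assms
proof (induction rule: list_all2_induct)
  case Nil
  show ?case by (rule theory_ofI[of _ "[]"]) simp_all
next
  case (Cons s ss S Ss)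
  then show ?case using theory_of_append[of "[s]" S ss "concat Ss"] by simp
qed

lemma theory_of_beta: "([App (lam x s) T], subst s x T) \<in> theory_of"
proof -
  obtain xs where xs: "set xs = (FV s - {x}) \<union> FVs T"
    using finite_list[of "(FV s - {x}) \<union> FVs T"] finite_FV finite_FVs by auto
  have fv: "FV (App (lam x s) T) \<subseteq> set xs"
    by (auto simp: xs FV_App FV_lam simp del: FV.simps)
  with FVs_subst[of s x T] xs show ?thesis
    by (intro theory_ofI[of _ xs]) (simp_all add: sems_singleton beta_sound del: FV.simps)
qed

lemma theory_of_beta_D:
  assumes "x \<notin> FV t"
  shows "([Dif (lam x s) t], lams x (dsubst s x [t])) \<in> theory_of"
proof -
  \<comment> \<open>Since \<open>x\<close> is not free in \<open>t\<close>, this choice keeps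
    \<open>x\<close> out of \<open>xs\<close>, as \<open>beta_D_sound\<close> demands.\<close>
  obtain xs where xs: "set xs = (FV s - {x}) \<union> FV t"
    using finite_list[of "(FV s - {x}) \<union> FV t"] finite_FV by auto
  have fv: "FV (Dif (lam x s) t) \<subseteq> set xs"
    by (auto simp: xs FV_lam)
  moreover have "FVs (lams x (dsubst s x [t])) \<subseteq> set xs"
    using FVs_dsubst[of s x "[t]"] by (auto simp: xs FVs_lams)
  moreover have "sem (Dif (lam x s) t) xs = sems (lams x (dsubst s x [t])) xs"
    using assms by (intro beta_D_sound) (auto simp: xs)
  ultimately show ?thesis
    by (intro theory_ofI[of _ xs]) (simp_all add: sems_singleton del: FV.simps)
qed

end

theorem theorem4p11:
  fixes C :: "('o, 'm, 'x) ccd_cat_scheme"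
    and U :: 'o and \<A> \<l> :: 'm
  assumes "cartesian_closed_differential_category C"
    and "linear_reflexive_object C U \<A> \<l>"
  shows "differential_lambda_theory (Th C U \<A> \<l>)"
proof -
  interpret linear_reflexive C U \<A> \<l>
    using assms by (simp add: linear_reflexive_def linear_reflexive_axioms_def)
  show ?thesis
    unfolding differential_lambda_theory_def
    by (simp add: theory_of_equiv theory_of_dterm_eq theory_of_lam theory_of_App theory_of_Dif
        theory_of_concat theory_of_beta theory_of_beta_D)
qed

end
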